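(* Let $A_1,A_2\in\mathcal{A}\setminus\{A_M\}$ and let $\tau_{A_1},\tau_{A_2}$ be the Kendall's $\tau$s of the extreme-value copulas $C_{A_1},C_{A_2}$. Let $\psi_1,\psi_2\in\Psi$ and let $C_{\psi_1,A_1},C_{\psi_2,A_2}$ be the corresponding Archimax copulas. Then $C_{\psi_1,A_1}(x,y)=C_{\psi_2,A_2}(x,y)$ for every $x,y\in\mathbb{I}$ if and only if one of the following two cases holds: (1) $\tau_{A_1}\le\tau_{A_2}$ and, for every $z\in[0,\infty)$ and $t\in\mathbb{I}$, $$\psi_1(z)=(\psi_2)_{\frac{1-\tau_{A_2}}{1-\tau_{A_1}}}(z)\quad\text{and}\quad A_2(t)=(A_1)_{\frac{1-\tau_{A_1}}{1-\tau_{A_2}}}(t);$$ (2) $\tau_{A_1}>\tau_{A_2}$ and, for every $z\in[0,\infty)$ and $t\in\mathbb{I}$, $$\psi_2(z)=(\psi_1)_{\frac{1-\tau_{A_1}}{1-\tau_{A_2}}}(z)\quad\text{and}\quad A_1(t)=(A_2)_{\frac{1-\tau_{A_2}}{1-\tau_{A_1}}}(t).$$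
   Context: Write $\mathbb{I}=[0,1]$. $\Psi$ denotes the set of convex normalized (Archimedean) generators: continuous, non-increasing, convex $\psi:[0,\infty)\to\mathbb{I}$ with $\psi(0)=1$, $\lim_{z\to\infty}\psi(z)=0$, $\psi$ strictly decreasing on $[0,\inf\{x:\psi(x)=0\})$ (with $\inf\emptyset=\infty$), and $\psi(1)=\frac12$. The pseudo-inverse of $\psi$ is $\varphi:\mathbb{I}\to[0,\infty]$, $\varphi(y)=\inf\{z\in[0,\infty]:\psi(z)=y\}$ (with $\psi(\infty)=0$). $\mathcal{A}$ denotes the set of Pickands dependence functions, i.e. convex $A:\mathbb{I}\to\mathbb{I}$ with $\max\{1-x,x\}\le A(x)\le1$ for all $x$; $A_M(t)=\max\{t,1-t\}$. The extreme-value copula of $A$ is $C_A(x,y)=(xy)^{A(\log x/\log(xy))}$ on $(0,1)^2$, extended continuously to a copula on $\mathbb{I}^2$. Kendall's $\tau$ of a copula $C$ with associated measure $\mu_C$ is $\tau(C)=4\int_{\mathbb{I}^2}C\,d\mu_C-1$; $\tau_A:=\tau(C_A)\in[0,1]$, and $\tau_A<1$ if $A\ne A_M$. For $\psi\in\Psi$ with pseudo-inverse $\varphi$ and $A\in\mathcal{A}$ the Archimax copula $C_{\psi,A}$ is given by $C_{\psi,A}(x,y)=\psi\big((\varphi(x)+\varphi(y))A\big(\frac{\varphi(x)}{\varphi(x)+\varphi(y)}\big)\big)$ on $(0,1)^2$, extended continuously to a copula on $\mathbb{I}^2$. For $\alpha\in(0,\infty)$: $(\psi)_\alpha(z):=\psi(z^\alpha)$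 for $z\in[0,\infty)$, and $(A)_\alpha(t):=(t^\alpha+(1-t)^\alpha)^{1/\alpha}\Big[A\Big(\frac{t^\alpha}{t^\alpha+(1-t)^\alpha}\Big)\Big]^{1/\alpha}$ for $t\in\mathbb{I}$. *)

theory Defs
  imports "HOL-Analysis.Analysis"
begin

text \<open>
  Functions on \<open>[0,1]\<close>, \<open>[0,\<infinity>)\<close> and \<open>[0,1]\<^sup>2\<close> are total functions on the reals; only their
  values on the intended domain are constrained, and they are only ever compared there.
\<close>

section \<open>Copulas\<close>

definition copula :: "(real \<Rightarrow> real \<Rightarrow> real) \<Rightarrow> bool" where
  "copula C \<longleftrightarrow>
     (\<forall>x\<in>{0..1}. C x 0 = 0 \<and> C 0 x = 0 \<and> C x 1 = x \<and> C 1 x = x) \<and>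
     (\<forall>x\<in>{0..1}. \<forall>x'\<in>{0..1}. \<forall>y\<in>{0..1}. \<forall>y'\<in>{0..1}. x \<le> x' \<longrightarrow> y \<le> y' \<longrightarrow>
        0 \<le> C x' y' - C x y' - C x' y + C x y)"

text \<open>
  The extension to \<open>[0,1]\<^sup>2\<close> of a function given on \<open>(0,1)\<^sup>2\<close> that is meant to be a copula: on the
  boundary every copula has the values below (see \<open>copula_eq_extend_copula\<close>).
\<close>

definition extend_copula :: "(real \<Rightarrow> real \<Rightarrow> real) \<Rightarrow> real \<Rightarrow> real \<Rightarrow> real" where
  "extend_copula f x y =
     (if x = 0 \<or> y = 0 then 0 else if x = 1 then y else if y = 1 then x else f x y)"

lemma copula_eq_extend_copula:
  assumes "copula C"
    and "\<And>x y. x \<in> {0<..<1} \<Longrightarrow> y \<in> {0<..<1} \<Longrightarrow> C x y = f x y"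
    and "x \<in> {0..1}" "y \<in> {0..1}"
  shows "C x y = extend_copula f x y"
  using assms unfolding copula_def extend_copula_def by auto

text \<open>
  The measure \<open>\<mu>\<^sub>C\<close> on \<open>[0,1]\<^sup>2\<close> determined by \<open>\<mu>\<^sub>C([0,x] \<times> [0,y]) = C(x,y)\<close>; its \<open>\<sigma>\<close>-algebra, generated
  by these rectangles, is the Borel \<open>\<sigma>\<close>-algebra of \<open>[0,1]\<^sup>2\<close>.
\<close>

definition copula_measure :: "(real \<Rightarrow> real \<Rightarrow> real) \<Rightarrow> (real \<times> real) measure" where
  "copula_measure C = extend_measure ({0..1} \<times> {0..1}) ({0..1} \<times> {0..1})
     (\<lambda>(x, y). {0..x} \<times> {0..y}) (\<lambda>(x, y). ennreal (C x y))"

lemma sets_copula_measure: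
  "sets (copula_measure C) = sets (restrict_space borel ({0..1} \<times> {0..1}))"
proof -
  define I :: "(real \<times> real) set" where "I = {0..1} \<times> {0..1}"
  define G where "G = (\<lambda>(x, y). {0..x::real} \<times> {0..y::real}) ` I"
  define H where "H = (\<lambda>(a, i). {p :: real \<times> real. p \<bullet> i \<le> a}) ` (UNIV \<times> Basis)"
  define K where "K = (\<inter>) I ` H"
  have G_sub: "G \<subseteq> Pow I" by (auto simp: G_def I_def)
  have K_sub: "K \<subseteq> Pow I" by (auto simp: K_def)
  have "I \<in> sets borel" by (simp add: borel_Times I_def)
  have borel: "sets (borel :: (real \<times> real) measure) = sigma_sets UNIV H"
    unfolding H_def by (subst borel_eq_halfspace_le) (auto intro!: sets_measure_of)
  have K_I: "I \<inter> {p. p \<bullet> i \<le> a} \<in> K" if "i \<in> Basis" for i a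
    unfolding K_def H_def using that by (intro imageI image_eqI[of _ _ "(a, i)"]) auto
  have "sigma_sets I G = sigma_sets I K"
  proof (rule sigma_sets_eqI)
    fix A assume "A \<in> G"
    then obtain x y where xy: "(x, y) \<in> I" and A: "A = {0..x} \<times> {0..y}"
      by (auto simp: G_def)
    interpret S: sigma_algebra I "sigma_sets I K"
      by (rule sigma_algebra_sigma_sets) fact
    have "A = (I \<inter> {p. p \<bullet> (1, 0) \<le> x}) \<inter> (I \<inter> {p. p \<bullet> (0, 1) \<le> y})"
      using xy unfolding A I_def by auto
    moreover have "(1, 0) \<in> (Basis :: (real \<times> real) set)" "(0, 1) \<in> (Basis :: (real \<times> real) set)"
      by (auto simp: Basis_prod_def)
    ultimately show "A \<in> sigma_sets I K"
      by (simp only: S.Int[OF sigma_sets.Basic sigma_sets.Basic] K_I)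
  next
    fix B assume "B \<in> K"
    then obtain a i where i: "i \<in> Basis" and B: "B = I \<inter> {p. p \<bullet> i \<le> a}"
      by (auto simp: K_def H_def)
    have G_I: "{0..x} \<times> {0..y} \<in> sigma_sets I G" if "(x, y) \<in> I" for x y
      using that by (auto simp: G_def intro!: sigma_sets.Basic)
    have "i = (1, 0) \<or> i = (0, 1)" using i by (auto simp: Basis_prod_def)
    moreover have "B = (if a < 0 then {} else {0..min a 1} \<times> {0..1})" if "i = (1, 0)"
      unfolding B I_def that by auto
    moreover have "B = (if a < 0 then {} else {0..1} \<times> {0..min a 1})" if "i = (0, 1)"
      unfolding B I_def that by auto
    moreover have "{0..min a 1} \<times> {0..1} \<in> sigma_sets I G" "{0..1} \<times> {0..min a 1} \<in> sigma_sets I G"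
      if "\<not> a < 0"
      using that G_I[of "min a 1" 1] G_I[of 1 "min a 1"] by (simp_all add: I_def)
    ultimately show "B \<in> sigma_sets I G"
      by (cases "a < 0") (auto simp: sigma_sets.Empty)
  qed
  also have "\<dots> = (\<inter>) I ` sigma_sets UNIV H"
    unfolding K_def using \<open>I \<in> sets borel\<close> by (intro sigma_sets_Int[symmetric]) (auto simp: borel)
  finally have "sigma_sets I G = (\<inter>) I ` sets borel" by (simp only: borel)
  then show ?thesis
    using G_sub unfolding copula_measure_def G_def I_def
    by (simp add: sets_extend_measure sets_restrict_space)
qed

lemma copula_measure_eqI:
  assumes sets: "sets M = sets (restrict_space borel ({0..1} \<times> {0..1}))"
    and eq: "\<And>x y. x \<in> {0..1} \<Longrightarrow> y \<in> {0..1} \<Longrightarrow> emeasure M ({0..x} \<times> {0..y}) = ennreal (C x y)"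
  shows "copula_measure C = M"
proof -
  let ?I = "{0..1} \<times> {0..1} :: (real \<times> real) set"
  let ?G = "(\<lambda>(x, y). {0..x} \<times> {0..y}) ` ?I :: (real \<times> real) set set"
  have G_sub: "?G \<subseteq> Pow ?I" by auto
  have sigma: "sets (copula_measure C) = sigma_sets ?I ?G"
    using G_sub by (simp add: copula_measure_def sets_extend_measure)
  have rect: "emeasure (copula_measure C) ({0..x} \<times> {0..y}) = ennreal (C x y)"
    if "x \<in> {0..1}" "y \<in> {0..1}" for x y
    using emeasure_extend_measure[OF copula_measure_def, of "emeasure M" C "(x, y)"] G_sub that eq
      emeasure_positive[of M] emeasure_countably_additive[of M]
    by (auto simp: sets sets_copula_measure)
  show ?thesis
  proof (rule measure_eqI_generator_eq[where \<Omega> = ?I and E = ?G and A = "\<lambda>_. ?I"])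
    show "Int_stable ?G"
    proof (rule Int_stableI)
      fix a b assume "a \<in> ?G" "b \<in> ?G"
      then obtain x y x' y' where "(x, y) \<in> ?I" "(x', y') \<in> ?I"
        "a = {0..x} \<times> {0..y}" "b = {0..x'} \<times> {0..y'}" by auto
      then show "a \<inter> b \<in> ?G" by (intro image_eqI[of _ _ "(min x x', min y y')"]) auto
    qed
    show "range (\<lambda>_. ?I) \<subseteq> ?G" by (auto intro!: image_eqI[of _ _ "(1, 1)"])
    show "sets M = sigma_sets ?I ?G" using sets sigma sets_copula_measure by simp
    show "emeasure (copula_measure C) ?I \<noteq> \<infinity>" using rect[of 1 1] by simp
  qed (use G_sub sigma rect eq in auto)
qed

definition kendall_tau :: "(real \<Rightarrow> real \<Rightarrow> real) \<Rightarrow> real" where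
  "kendall_tau C = 4 * (LINT (x, y)|copula_measure C. C x y) - 1"

section \<open>Pickands dependence functions and extreme-value copulas\<close>

definition pickands :: "(real \<Rightarrow> real) \<Rightarrow> bool" where
  "pickands A \<longleftrightarrow> convex_on {0..1} A \<and> (\<forall>x\<in>{0..1}. max (1 - x) x \<le> A x \<and> A x \<le> 1)"

definition pickands_M :: "real \<Rightarrow> real" where
  "pickands_M t = max t (1 - t)"

definition ev_copula :: "(real \<Rightarrow> real) \<Rightarrow> real \<Rightarrow> real \<Rightarrow> real" where
  "ev_copula A = extend_copula (\<lambda>x y. (x * y) powr A (ln x / ln (x * y)))"

definition tau_pickands :: "(real \<Rightarrow> real) \<Rightarrow> real" where
  "tau_pickands A = kendall_tau (ev_copula A)"

section \<open>Archimedean generators and Archimax copulas\<close>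

text \<open>The infimum is taken in the extended reals, where \<open>Inf {} = \<infinity>\<close>.\<close>

definition generator :: "(real \<Rightarrow> real) \<Rightarrow> bool" where
  "generator \<psi> \<longleftrightarrow>
     (\<forall>z\<ge>0. \<psi> z \<in> {0..1}) \<and>
     continuous_on {0..} \<psi> \<and> antimono_on {0..} \<psi> \<and> convex_on {0..} \<psi> \<and>
     \<psi> 0 = 1 \<and> (\<psi> \<longlongrightarrow> 0) at_top \<and>
     strict_antimono_on {z. 0 \<le> z \<and> ereal z < Inf {ereal x |x. 0 \<le> x \<and> \<psi> x = 0}} \<psi> \<and>
     \<psi> 1 = 1 / 2"

definition generator_ext :: "(real \<Rightarrow> real) \<Rightarrow> ennreal \<Rightarrow> real" where
  "generator_ext \<psi> z = (if z = \<infinity> then 0 else \<psi> (enn2real z))"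

definition pseudo_inverse :: "(real \<Rightarrow> real) \<Rightarrow> real \<Rightarrow> ennreal" where
  "pseudo_inverse \<psi> y = Inf {z. generator_ext \<psi> z = y}"

text \<open>For a generator and \<open>x \<in> (0,1)\<close> the pseudo-inverse is finite and positive, so \<open>enn2real\<close> loses
  nothing and the quotient is defined.\<close>

definition archimax :: "(real \<Rightarrow> real) \<Rightarrow> (real \<Rightarrow> real) \<Rightarrow> real \<Rightarrow> real \<Rightarrow> real" where
  "archimax \<psi> A = extend_copula (\<lambda>x y.
     let u = enn2real (pseudo_inverse \<psi> x); v = enn2real (pseudo_inverse \<psi> y)
     in \<psi> ((u + v) * A (u / (u + v))))"

definition generator_pow :: "real \<Rightarrow> (real \<Rightarrow> real) \<Rightarrow> real \<Rightarrow> real" where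
  "generator_pow \<alpha> \<psi> z = \<psi> (z powr \<alpha>)"

definition pickands_pow :: "real \<Rightarrow> (real \<Rightarrow> real) \<Rightarrow> real \<Rightarrow> real" where
  "pickands_pow \<alpha> A t =
     (t powr \<alpha> + (1 - t) powr \<alpha>) powr (1 / \<alpha>) *
     A (t powr \<alpha> / (t powr \<alpha> + (1 - t) powr \<alpha>)) powr (1 / \<alpha>)"

end

theory Submission
  imports Defs "HOL-Real_Asymp.Real_Asymp"
begin

text \<open>
  Write \<open>N\<^sub>A(u,v) = (u + v) A(u / (u + v))\<close> for the stable tail dependence function \<open>tail_dep A\<close>
  of a Pickands function. It is homogeneous of degree one, and in these terms
  \<open>C\<^sub>A(x,y) = exp (- N\<^sub>A(- ln x, - ln y))\<close>, \<open>C\<^sub>\<psi>\<^sub>,\<^sub>A(x,y) = \<psi> (N\<^sub>A(\<phi> x, \<phi> y))\<close>, and \<open>A\<^sub>1 = (A\<^sub>2)\<^sub>\<gamma>\<close>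
  says that \<open>N\<^sub>1(u,v) powr \<gamma> = N\<^sub>2(u powr \<gamma>, v powr \<gamma>)\<close>. The theorem rests on two facts.

  \<^bold>\<open>Rigidity.\<close> If two Archimax copulas agree, then the increasing function \<open>f = \<phi>\<^sub>2 \<circ> \<psi>\<^sub>1\<close> intertwines
  the tail dependence functions, \<open>f (N\<^sub>1(u,v)) = N\<^sub>2(f u, f v)\<close>. On the diagonal this reads
  \<open>f (c u) = d f(u)\<close> with \<open>c = N\<^sub>1(1,1)\<close>, and \<open>c > 1\<close> because \<open>A\<^sub>1\<close> is not \<open>A\<^sub>M\<close>. So for fixed
  \<open>s \<le> 1\<close> the ratio \<open>F u = f (s u) / f u\<close> is invariant under \<open>u \<mapsto> c u\<close> and attains its maximum, say
  at \<open>m\<close>. Since \<open>N\<^sub>2\<close> is homogeneous and monotone, \<open>F (N\<^sub>1(u,v))\<close> can be maximal only if \<open>F u\<close> is,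
  whenever \<open>N\<^sub>1\<close> is strictly increasing in its first argument at \<open>(u,v)\<close>. Representing \<open>m\<close> as
  \<open>N\<^sub>1(u, r u)\<close> with \<open>0 < r \<le> 1\<close> yields every \<open>u\<close> in \<open>[m / c, m)\<close>, a whole period; hence \<open>F\<close> is
  constant, \<open>f\<close> is multiplicative, and \<open>f\<close> is a power function (\<open>intertwiner_is_power\<close>).
  The consequence is
  \<open>\<psi>\<^sub>1(z) = \<psi>\<^sub>2(z powr \<gamma>)\<close> and \<open>A\<^sub>1 = (A\<^sub>2)\<^sub>\<gamma>\<close> for some \<open>\<gamma> > 0\<close>
  (\<open>rescaled_if_archimax_eq\<close>); the converse is a direct computation (\<open>archimax_eq_if_rescaled\<close>).

  \<^bold>\<open>The exponent.\<close> Put \<open>H r = N\<^sub>A(1,r)\<close> and let \<open>D\<close> be its left derivative. Then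
  \<open>1 - \<tau>\<^sub>A\<close> is the integral of \<open>D (H - r D) / H\<^sup>2\<close> over the half-line
  (\<open>tau_pickands_integral\<close>). In the variable \<open>\<theta> = ln r\<close>, with \<open>\<ell>(\<theta>) = ln (H (exp \<theta>))\<close>, this is the integral of
  \<open>\<ell>' (1 - \<ell>')\<close> over the line, and the relation above becomes \<open>\<gamma> \<ell>\<^sub>1(\<theta>) = \<ell>\<^sub>2(\<gamma> \<theta>)\<close>. Hence
  \<open>\<gamma> (1 - \<tau>\<^sub>1) = 1 - \<tau>\<^sub>2\<close> (\<open>tau_pickands_rescale\<close>), and since the integral is positive unless \<open>A = A\<^sub>M\<close>
  (\<open>tau_pickands_less_one\<close>) this determines \<open>\<gamma>\<close>. The two cases of the theorem say the same thing with the
  roles of the two pairs exchanged.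

  The integral formula comes from an explicit random vector with distribution function \<open>C\<^sub>A\<close>: its first
  component is uniform, and the conditional distribution function of the second one, a one-sided partial derivative
  of \<open>C\<^sub>A\<close>, is inverted. A Pickands function may have countably many kinks, so
  the fundamental theorem of calculus is used with countably many exceptional points.
\<close>

section \<open>Left slopes of convex functions\<close>

definition left_slope :: "(real \<Rightarrow> real) \<Rightarrow> real \<Rightarrow> real" where
  "left_slope f x = (SUP s\<in>{..<x}. (f x - f s) / (x - s))"

lemma convex_secant_le:
  fixes f :: "real \<Rightarrow> real"
  assumes "convex_on UNIV f" "s < x" "x < y"
  shows "(f x - f s) / (x - s) \<le> (f y - f x) / (y - x)"
proof -
  have "(f s - f x) / (s - x) \<le> (f x - f y) / (x - y)"
    using convex_on_slope_le[OF assms(1), of s y x] assms(2,3) by auto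
  then show ?thesis by (metis minus_diff_eq minus_divide_divide)
qed

lemma bdd_above_secants:
  fixes f :: "real \<Rightarrow> real"
  assumes "convex_on UNIV f"
  shows "bdd_above ((\<lambda>s. (f x - f s) / (x - s)) ` {..<x})"
  using convex_secant_le[OF assms, of _ x "x + 1"]
  by (intro bdd_aboveI2[of _ _ "(f (x + 1) - f x) / (x + 1 - x)"]) auto

lemma left_slope_subgradient:
  assumes "convex_on UNIV f"
  shows "f x + left_slope f x * (y - x) \<le> f y"
proof (cases y x rule: linorder_cases)
  case less
  have "(f x - f y) / (x - y) \<le> left_slope f x"
    unfolding left_slope_def using less by (intro cSUP_upper bdd_above_secants assms) auto
  with less show ?thesis by (simp add: field_simps)
next
  case greater
  have "left_slope f x \<le> (f y - f x) / (y - x)"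
    unfolding left_slope_def using greater by (intro cSUP_least) (auto intro: convex_secant_le assms)
  with greater show ?thesis by (simp add: field_simps)
qed auto

lemma left_slope_mono:
  assumes "convex_on UNIV f"
  shows "mono (left_slope f)"
proof (rule monoI)
  fix x y :: real assume "x \<le> y"
  have "0 \<le> (left_slope f y - left_slope f x) * (y - x)"
    using left_slope_subgradient[OF assms, of x y] left_slope_subgradient[OF assms, of y x]
    by (simp add: algebra_simps)
  with \<open>x \<le> y\<close> show "left_slope f x \<le> left_slope f y"
    by (cases "x = y") (auto simp: zero_le_mult_iff)
qed

lemma convex_isCont:
  fixes f :: "real \<Rightarrow> real"
  assumes "convex_on UNIV f"
  shows "isCont f x"
  using convex_on_continuous[OF open_UNIV assms] by (simp add: continuous_on_eq_continuous_at)

text \<open>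
  A left slope is a supremum of secant slopes, each of which varies continuously with its right
  endpoint.
\<close>
lemma left_slope_left_continuous:
  assumes "convex_on UNIV f"
  shows "(left_slope f \<longlongrightarrow> left_slope f x) (at_left x)"
proof (rule order_tendstoI)
  fix a assume "left_slope f x < a"
  then show "\<forall>\<^sub>F y in at_left x. left_slope f y < a"
    by (intro eventually_at_leftI[of "x - 1"])
      (auto intro!: le_less_trans[OF monoD[OF left_slope_mono[OF assms], of _ x]])
next
  fix a assume "a < left_slope f x"
  then obtain s where s: "s < x" "a < (f x - f s) / (x - s)"
    unfolding left_slope_def by (subst (asm) less_cSUP_iff) (auto intro: bdd_above_secants assms)
  have "((\<lambda>y. (f y - f s) / (y - s)) \<longlongrightarrow> (f x - f s) / (x - s)) (at_left x)"
    using convex_isCont[OF assms, of x] s(1)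
    by (intro tendsto_intros) (auto simp: isCont_def intro: tendsto_within_subset)
  then have "\<forall>\<^sub>F y in at_left x. a < (f y - f s) / (y - s)"
    using s(2) by (rule order_tendstoD)
  moreover have "\<forall>\<^sub>F y in at_left x. s < y"
    using s(1) by (intro eventually_at_leftI[of s]) auto
  ultimately show "\<forall>\<^sub>F y in at_left x. a < left_slope f y"
  proof eventually_elim
    case (elim y)
    have "(f y - f s) / (y - s) \<le> left_slope f y"
      unfolding left_slope_def using elim by (intro cSUP_upper bdd_above_secants assms) auto
    with elim show ?case by linarith
  qed
qed

text \<open>
  The difference quotients at \<open>x\<close> lie between the left slopes at the two endpoints, so they converge
  where the left slope is continuous; a monotone function is continuous off a countable set.
\<close>
lemma left_slope_has_real_derivative:
  assumes "convex_on UNIV f" and "isCont (left_slope f) x"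
  shows "(f has_real_derivative left_slope f x) (at x)"
proof -
  let ?D = "left_slope f"
  have D: "((\<lambda>y. max (?D x) (?D y)) \<longlongrightarrow> ?D x) (at x)" "((\<lambda>y. min (?D x) (?D y)) \<longlongrightarrow> ?D x) (at x)"
    using tendsto_max[of "\<lambda>_. ?D x" "?D x" "at x" ?D "?D x"]
      tendsto_min[of "\<lambda>_. ?D x" "?D x" "at x" ?D "?D x"] assms(2) by (auto simp: isCont_def)
  have bnd: "min (?D x) (?D y) \<le> (f y - f x) / (y - x) \<and> (f y - f x) / (y - x) \<le> max (?D x) (?D y)"
    if "y \<noteq> x" for y
    using that left_slope_subgradient[OF assms(1), of x y] left_slope_subgradient[OF assms(1), of y x]
      monoD[OF left_slope_mono[OF assms(1)], of x y] monoD[OF left_slope_mono[OF assms(1)], of y x]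
    by (cases "x < y") (auto simp: field_simps min_def max_def)
  show ?thesis
    unfolding has_field_derivative_iff
    by (rule tendsto_sandwich[OF _ _ D(2) D(1)]) (use bnd in \<open>auto simp: eventually_at_filter\<close>)
qed

section \<open>The fundamental theorem of calculus with countably many exceptions\<close>

text \<open>
  By Sard's lemma the points with zero derivative have a negligible image, and so does the
  countable rest; but the image of an interval is an interval.
\<close>
lemma zero_derivative_off_countable_imp_eq:
  fixes k :: "real \<Rightarrow> real"
  assumes "a \<le> b" and cont: "continuous_on {a..b} k" and "countable S"
    and der: "\<And>x. x \<in> {a<..<b} - S \<Longrightarrow> (k has_real_derivative 0) (at x)"
  shows "k a = k b"
proof (rule ccontr)
  assume ne: "k a \<noteq> k b"
  define T where "T = {a<..<b} - S"
  define E where "E = ({a..b} \<inter> S) \<union> {a, b}"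
  let ?v = "vec :: real \<Rightarrow> real^1"
  define F where "F x = ?v (k (x $ 1))" for x :: "real^1"
  have "negligible (F ` (?v ` T))"
  proof (rule baby_Sard)
    fix x :: "real^1" assume "x \<in> ?v ` T"
    then have x: "x $ 1 \<in> T" by auto
    have "(k has_derivative (\<lambda>_. 0)) (at (x $ 1))"
      using der[of "x $ 1"] x by (simp add: T_def has_field_derivative_def lambda_zero)
    then have "((\<lambda>x::real^1. k (x $ 1)) has_derivative (\<lambda>_. 0)) (at x)"
      using has_derivative_compose[of "\<lambda>x::real^1. x $ 1" "\<lambda>x. x $ 1" x UNIV k "\<lambda>_. 0"]
        bounded_linear_imp_has_derivative[OF bounded_linear_vec_nth, of 1 "at x"] by simp
    then have "((\<lambda>x::real^1. k (x $ 1) *\<^sub>R ?v 1) has_derivative (\<lambda>_. 0)) (at x)"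
      using has_derivative_scaleR_left by fastforce
    moreover have "F = (\<lambda>x. k (x $ 1) *\<^sub>R ?v 1)" by (auto simp: F_def vec_eq_iff)
    ultimately show "(F has_derivative (\<lambda>_. 0)) (at x within ?v ` T)"
      by (simp add: has_derivative_at_withinI)
    have "matrix (\<lambda>_::real^1. 0::real^1) = 0"
      by (simp add: matrix_def vec_eq_iff)
    then show "rank (matrix (\<lambda>_::real^1. 0::real^1)) < CARD(1)" by simp
  qed simp
  moreover have "F ` (?v ` T) = ?v ` (k ` T)" by (auto simp: F_def image_image)
  moreover have "countable (?v ` (k ` E))" using \<open>countable S\<close> by (auto simp: E_def)
  then have "negligible (?v ` (k ` E))" by (simp add: negligible_iff_null_sets null_sets_completionI countable_imp_null_set_lborel)
  ultimately have "negligible (?v ` (k ` T) \<union> ?v ` (k ` E))" by (auto intro: negligible_Un)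
  moreover have "cbox (?v (min (k a) (k b))) (?v (max (k a) (k b))) \<subseteq> ?v ` (k ` T) \<union> ?v ` (k ` E)"
  proof
    fix w assume "w \<in> cbox (?v (min (k a) (k b))) (?v (max (k a) (k b)))"
    then have w: "min (k a) (k b) \<le> w $ 1" "w $ 1 \<le> max (k a) (k b)" by (auto simp: mem_box_cart)
    have "\<exists>x. a \<le> x \<and> x \<le> b \<and> k x = w $ 1"
      using w IVT'[of k a "w $ 1" b] IVT2'[of k b "w $ 1" a] assms(1) cont
      by (cases "k a \<le> k b") auto
    then obtain x where x: "x \<in> {a..b}" "w = ?v (k x)" by (auto simp: vec_eq_iff)
    then have "x \<in> T \<union> E" by (auto simp: T_def E_def)
    with x show "w \<in> ?v ` (k ` T) \<union> ?v ` (k ` E)" by auto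
  qed
  ultimately have "negligible (cbox (?v (min (k a) (k b))) (?v (max (k a) (k b))))"
    by (rule negligible_subset)
  then show False
    using ne by (auto simp: negligible_interval interval_eq_empty_cart)
qed

text \<open>
  Where the integrand is continuous, the indefinite integral has the same derivative as \<open>F\<close>, so their
  difference falls under the previous lemma.
\<close>
lemma nn_integral_FTC_off_countable:
  fixes F f :: "real \<Rightarrow> real"
  assumes "a \<le> b" and cont: "continuous_on {a..b} F" and "countable S"
    and [measurable]: "f \<in> borel_measurable borel"
    and bnd: "\<And>x. x \<in> {a<..<b} \<Longrightarrow> 0 \<le> f x \<and> f x \<le> B"
    and der: "\<And>x. x \<in> {a<..<b} - S \<Longrightarrow> (F has_real_derivative f x) (at x)"
    and f: "\<And>x. x \<in> {a<..<b} - S \<Longrightarrow> isCont f x"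
  shows "(\<integral>\<^sup>+x. ennreal (f x) * indicator {a<..<b} x \<partial>lborel) = ennreal (F b - F a)"
proof -
  define f0 where "f0 x = (if x \<in> {a<..<b} then f x else 0)" for x
  have [measurable]: "f0 \<in> borel_measurable borel" unfolding f0_def by measurable
  have "set_integrable lborel {a..b} f0"
    unfolding set_integrable_def
  proof (rule Bochner_Integration.integrable_bound)
    show "integrable lborel (\<lambda>x. indicator {a..b} x * B)"
      by (intro integrable_mult_left integrable_real_indicator) (auto simp: emeasure_lborel_Icc_eq)
    show "AE x in lborel. norm (indicator {a..b} x *\<^sub>R f0 x) \<le> norm (indicator {a..b} x * B)"
      using bnd by (intro AE_I2) (fastforce simp: f0_def indicator_def)
  qed measurable
  then have int: "f0 integrable_on {a..b}" by (rule set_borel_integral_eq_integral)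
  define g where "g x = integral {a..x} f0" for x
  have g: "continuous_on {a..b} g" unfolding g_def by (rule indefinite_integral_continuous_1[OF int])
  have "F a - g a = F b - g b"
  proof (rule zero_derivative_off_countable_imp_eq[OF assms(1) _ \<open>countable S\<close>])
    show "continuous_on {a..b} (\<lambda>x. F x - g x)" by (intro continuous_intros cont g)
    fix x assume x: "x \<in> {a<..<b} - S"
    have ev: "\<forall>\<^sub>F y in nhds x. f0 y = f y"
      using x eventually_nhds_in_open[of "{a<..<b}" x] by (auto simp: f0_def elim!: eventually_mono)
    then have "isCont f0 x" using f[OF x] isCont_cong[of f0 f x] by simp
    then have "(g has_vector_derivative f0 x) (at x within {a..b} - {})"
      unfolding g_def using x continuous_at_imp_continuous_at_within
      by (intro integral_has_vector_derivative_continuous_at[OF int]) auto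
    then have "(g has_real_derivative f x) (at x)"
      using x at_within_Icc_at[of a x b] by (simp add: has_real_derivative_iff_has_vector_derivative f0_def)
    then show "((\<lambda>x. F x - g x) has_real_derivative 0) (at x)"
      using DERIV_diff[OF der[OF x]] by force
  qed
  then have "(f0 has_integral F b - F a) {a..b}"
    using integrable_integral[OF int] by (simp add: g_def)
  from nn_integral_has_integral_lebesgue'[OF _ this] bnd
  have "(\<integral>\<^sup>+x. ennreal (f0 x) * indicator {a..b} x \<partial>lborel) = ennreal (F b - F a)"
    by (auto simp: f0_def)
  moreover have "(\<integral>\<^sup>+x. ennreal (f0 x) * indicator {a..b} x \<partial>lborel) =
    (\<integral>\<^sup>+x. ennreal (f x) * indicator {a<..<b} x \<partial>lborel)"
    by (intro nn_integral_cong) (auto simp: f0_def indicator_def)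
  ultimately show ?thesis by simp
qed

section \<open>Stable tail dependence functions\<close>

definition tail_dep :: "(real \<Rightarrow> real) \<Rightarrow> real \<Rightarrow> real \<Rightarrow> real" where
  "tail_dep A u v = (u + v) * A (u / (u + v))"

lemma tail_dep_homogeneous: "c \<noteq> 0 \<Longrightarrow> tail_dep A (c * u) (c * v) = c * tail_dep A u v"
  by (simp add: tail_dep_def distrib_left[symmetric])

lemma tail_dep_reflect:
  "u + v \<noteq> 0 \<Longrightarrow> tail_dep (\<lambda>t. A (1 - t)) v u = tail_dep A u v"
  by (simp add: tail_dep_def add.commute field_simps)

lemma pickands_reflect:
  assumes "pickands A" shows "pickands (\<lambda>t. A (1 - t))"
  unfolding pickands_def
proof
  have A: "convex_on {0..1} A" using assms by (simp add: pickands_def)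
  show "convex_on {0..1} (\<lambda>t. A (1 - t))"
  proof (rule convex_onI)
    fix t x y :: real assume *: "0 < t" "t < 1" "x \<in> {0..1}" "y \<in> {0..1}"
    show "A (1 - ((1 - t) *\<^sub>R x + t *\<^sub>R y)) \<le> (1 - t) * A (1 - x) + t * A (1 - y)"
      using convex_onD[OF A, of t "1 - x" "1 - y"] * by (simp add: algebra_simps)
  qed simp
  show "\<forall>x\<in>{0..1}. max (1 - x) x \<le> A (1 - x) \<and> A (1 - x) \<le> 1"
  proof
    fix x :: real assume "x \<in> {0..1}"
    then have "max (1 - (1 - x)) (1 - x) \<le> A (1 - x) \<and> A (1 - x) \<le> 1"
      using assms unfolding pickands_def
      by (elim conjE) (drule bspec[of _ _ "1 - x"], auto)
    then show "max (1 - x) x \<le> A (1 - x) \<and> A (1 - x) \<le> 1" by simp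
  qed
qed

lemma tail_dep_bounds:
  assumes "pickands A" "0 \<le> u" "0 \<le> v" "0 < u + v"
  shows "u \<le> tail_dep A u v" "v \<le> tail_dep A u v" "tail_dep A u v \<le> u + v"
proof -
  have "u / (u + v) \<in> {0..1}" using assms by auto
  then have A: "max (1 - u / (u + v)) (u / (u + v)) \<le> A (u / (u + v))" "A (u / (u + v)) \<le> 1"
    using assms(1) unfolding pickands_def by auto
  have "(u + v) * (u / (u + v)) \<le> tail_dep A u v"
    unfolding tail_dep_def using A assms by (intro mult_left_mono) auto
  moreover have "(u + v) * (1 - u / (u + v)) \<le> tail_dep A u v"
    unfolding tail_dep_def using A assms by (intro mult_left_mono) auto
  moreover have "tail_dep A u v \<le> (u + v) * 1"
    unfolding tail_dep_def using A assms by (intro mult_left_mono) auto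
  ultimately show "u \<le> tail_dep A u v" "v \<le> tail_dep A u v" "tail_dep A u v \<le> u + v"
    using assms by (auto simp: right_diff_distrib)
qed

text \<open>
  Continuing the section \<open>r \<mapsto> tail_dep A 1 r\<close> by its boundary value to the left of \<open>0\<close> keeps it
  convex and makes it total, so that no boundary point of its domain needs attention later.
\<close>
definition tail_section :: "(real \<Rightarrow> real) \<Rightarrow> real \<Rightarrow> real" where
  "tail_section A r = (if r \<le> 0 then 1 else tail_dep A 1 r)"

lemma tail_dep_eq_tail_section:
  "0 < u \<Longrightarrow> 0 < v \<Longrightarrow> tail_dep A u v = u * tail_section A (v / u)"
  using tail_dep_homogeneous[of u A 1 "v / u"] by (simp add: tail_section_def divide_le_0_iff)

text \<open>
  Everything about Kendall's tau depends on the tail dependence function only through this section, and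
  only through the following properties.
\<close>
locale stable_section =
  fixes H :: "real \<Rightarrow> real"
  assumes convex: "convex_on UNIV H"
    and left: "r \<le> 0 \<Longrightarrow> H r = 1"
    and bounds: "0 \<le> r \<Longrightarrow> max 1 r \<le> H r \<and> H r \<le> 1 + r"

text \<open>On the half-line the section is the perspective of \<open>A\<close>, and perspectives preserve convexity.\<close>
lemma tail_section_convex_nonneg:
  assumes "pickands A" "0 \<le> x" "0 \<le> y" "0 \<le> t" "t \<le> 1"
  shows "tail_section A ((1 - t) * x + t * y) \<le> (1 - t) * tail_section A x + t * tail_section A y"
proof -
  have A: "convex_on {0..1} A" using assms by (simp add: pickands_def)
  have "A 1 = 1" using assms(1) unfolding pickands_def by (auto dest!: bspec[of _ _ 1])
  then have H: "tail_section A r = (1 + r) * A (1 / (1 + r))" if "0 \<le> r" for r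
    using that by (cases "r = 0") (auto simp: tail_section_def tail_dep_def)
  define z where "z = (1 - t) * x + t * y"
  have z: "0 \<le> z" unfolding z_def using assms by (intro add_nonneg_nonneg mult_nonneg_nonneg) auto
  define w where "w = t * (1 + y) / (1 + z)"
  have w1: "1 - w = (1 - t) * (1 + x) / (1 + z)"
    using z by (simp add: w_def z_def field_simps)
  have w: "0 \<le> w" "w \<le> 1"
  proof -
    show "0 \<le> w" using assms z by (simp add: w_def)
    have "0 \<le> 1 - w" unfolding w1 using assms z by simp
    then show "w \<le> 1" by simp
  qed
  have "1 / (1 + z) = (1 - w) * (1 / (1 + x)) + w * (1 / (1 + y))"
    unfolding w1 using assms(2,3) by (simp add: w_def add_divide_distrib[symmetric])
  then have "A (1 / (1 + z)) \<le> (1 - w) * A (1 / (1 + x)) + w * A (1 / (1 + y))"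
    using convex_onD[OF A, of w "1 / (1 + x)" "1 / (1 + y)"] w assms(2,3) by simp
  then have "(1 + z) * A (1 / (1 + z)) \<le> (1 + z) * ((1 - w) * A (1 / (1 + x)) + w * A (1 / (1 + y)))"
    using z by (intro mult_left_mono) auto
  also have "\<dots> = (1 - t) * ((1 + x) * A (1 / (1 + x))) + t * ((1 + y) * A (1 / (1 + y)))"
  proof -
    have "(1 + z) * (1 - w) = (1 - t) * (1 + x)" "(1 + z) * w = t * (1 + y)"
      using z by (simp_all only: w1) (simp_all add: w_def)
    then show ?thesis by (simp add: distrib_left mult.assoc[symmetric])
  qed
  finally show ?thesis
    using H[OF z] H[of x] H[of y] assms(2,3) by (simp add: z_def)
qed

lemma stable_section_tail_section:
  assumes "pickands A" shows "stable_section (tail_section A)"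
proof
  let ?H = "tail_section A"
  show left: "?H r = 1" if "r \<le> 0" for r using that by (simp add: tail_section_def)
  show bounds: "max 1 r \<le> ?H r \<and> ?H r \<le> 1 + r" if "0 \<le> r" for r
    using that tail_dep_bounds[OF assms, of 1 r] by (auto simp: tail_section_def)
  have ge1: "1 \<le> ?H r" for r using left[of r] bounds[of r] by (cases "r \<le> 0") auto
  show "convex_on UNIV ?H"
  proof (rule convex_on_linorderI)
    fix t x y :: real assume *: "0 < t" "t < 1" "x < y"
    let ?z = "(1 - t) * x + t * y"
    have rhs: "1 \<le> (1 - t) * ?H x + t * ?H y"
      using mult_left_mono[OF ge1[of x], of "1 - t"] mult_left_mono[OF ge1[of y], of t] *
      by (simp only: mult_1_right) linarith
    consider "?z \<le> 0" | "0 \<le> x" "0 < ?z" | "x < 0" "0 < ?z" by linarith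
    then have "?H ?z \<le> (1 - t) * ?H x + t * ?H y"
    proof cases
      case 1
      then show ?thesis using rhs left by simp
    next
      case 2
      then show ?thesis using tail_section_convex_nonneg[OF assms, of x y t] * by simp
    next
      \<comment> \<open>Only the part of the chord over \<open>[0, y]\<close> matters: moving the left end from \<open>x\<close> to \<open>0\<close> lowers the chord.\<close>
      case 3
      have "(1 - t) * x < 0" using 3 * by (simp add: mult_pos_neg)
      with 3 have "0 < t * y" by linarith
      with * have y: "0 < y" by (simp add: zero_less_mult_iff)
      have s: "0 \<le> ?z / y" "?z / y \<le> t"
        using 3 y \<open>(1 - t) * x < 0\<close> by (auto simp: divide_le_eq)
      have "?H ((1 - ?z / y) * 0 + ?z / y * y) \<le> (1 - ?z / y) * ?H 0 + ?z / y * ?H y"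
        using tail_section_convex_nonneg[OF assms order_refl less_imp_le[OF y] s(1)] s(2) * by linarith
      then have "?H ?z \<le> (1 - ?z / y) * ?H 0 + ?z / y * ?H y" using y by simp
      also have "\<dots> = 1 + ?z / y * (?H y - 1)" using left[of 0] by (simp add: left_diff_distrib right_diff_distrib)
      also have "\<dots> \<le> 1 + t * (?H y - 1)"
        using s ge1[of y] by (intro add_left_mono mult_right_mono) auto
      also have "\<dots> = (1 - t) * ?H x + t * ?H y" using left[of x] 3 by (simp add: algebra_simps)
      finally show ?thesis .
    qed
    then show "?H ((1 - t) *\<^sub>R x + t *\<^sub>R y) \<le> (1 - t) * ?H x + t * ?H y" by simp
  qed simp
qed

context stable_section
begin

lemma ge_one: "1 \<le> H r"
  using left[of r] bounds[of r] by (cases "r \<le> 0") auto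

lemma ge_self: "r \<le> H r"
  using left[of r] bounds[of r] by (cases "r \<le> 0") auto

lemma pos: "0 < H r"
  using ge_one[of r] by linarith

lemma cont: "isCont H r"
  by (rule convex_isCont[OF convex])

lemma continuous_H: "continuous_on S H"
  by (simp add: continuous_at_imp_continuous_on cont)

lemma chord_le:
  assumes "0 \<le> r" "r \<le> s" shows "H r \<le> 1 + r / s * (H s - 1)"
proof (cases "s = 0")
  case False
  then have s: "0 < s" using assms by simp
  have "H ((1 - r / s) * 0 + r / s * s) \<le> (1 - r / s) * H 0 + r / s * H s"
    using convex_onD[OF convex, of "r / s" 0 s] assms s by auto
  then show ?thesis using s left[of 0] by (simp add: algebra_simps)
qed (use assms left[of 0] in simp)

lemma strict_mono_above_one:
  assumes "r < s" "1 < H s" shows "H r < H s"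
proof (cases "0 \<le> r")
  case True
  have "H r \<le> 1 + r / s * (H s - 1)" using chord_le[of r s] True assms by simp
  also have "\<dots> < 1 + 1 * (H s - 1)"
    using True assms by (intro add_strict_left_mono mult_strict_right_mono) auto
  finally show ?thesis by simp
qed (use assms left[of r] in auto)

lemma H_mono:
  assumes "r \<le> s" shows "H r \<le> H s"
proof (cases "r = s \<or> 1 < H s \<or> r < 0")
  case True
  then show ?thesis
    using strict_mono_above_one[of r s] assms ge_one[of s] left[of r] by (auto simp: less_le)
next
  case False
  then show ?thesis using chord_le[of r s] ge_one[of s] assms by simp
qed

abbreviation "D \<equiv> left_slope H"

lemma subgradient: "H x + D x * (y - x) \<le> H y"
  by (rule left_slope_subgradient[OF convex])

lemma D_mono: "x \<le> y \<Longrightarrow> D x \<le> D y"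
  using left_slope_mono[OF convex] by (auto dest: monoD)

lemma D_left: "r \<le> 0 \<Longrightarrow> D r = 0"
  by (simp add: left_slope_def left)

lemma D_nonneg: "0 \<le> D r"
  using D_mono[of 0 r] D_left[of r] D_left[of 0] by (cases "r \<le> 0") auto

text \<open>A larger slope would break the bound \<open>H s \<le> 1 + s\<close> far out on the line of support.\<close>
lemma D_le_one: "D r \<le> 1"
proof (rule ccontr)
  assume "\<not> D r \<le> 1"
  then have *: "0 < D r - 1" and r: "0 < r" using D_left[of r] by (auto simp: not_le intro: ccontr)
  have "H r + D r * (2 / (D r - 1)) \<le> 1 + (r + 2 / (D r - 1))"
    using subgradient[of r "r + 2 / (D r - 1)"] bounds[of "r + 2 / (D r - 1)"] * r by auto
  moreover have "D r * (2 / (D r - 1)) = 2 + 2 / (D r - 1)" using * by (simp add: field_simps)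
  ultimately show False using ge_self[of r] by linarith
qed

text \<open>
  The intercept of a line of support. By homogeneity it is, away from kinks, the partial derivative of the
  tail dependence function in its first argument, as \<open>D\<close> is the one in the second argument.
\<close>
definition intercept :: "real \<Rightarrow> real" where
  "intercept r = H r - r * D r"

lemma intercept_le_one: "intercept r \<le> 1"
  using subgradient[of r 0] left[of 0] by (simp add: intercept_def algebra_simps)

lemma intercept_nonneg: "0 \<le> intercept r"
proof (cases "r \<le> 0")
  case False
  then have "r * D r \<le> r * 1" using D_le_one[of r] by (intro mult_left_mono) auto
  then show ?thesis using ge_self[of r] by (simp add: intercept_def)
qed (simp add: intercept_def left D_left)

lemma intercept_antimono:
  assumes "r \<le> s" shows "intercept s \<le> intercept r"
proof (cases "r \<le> 0")
  case True
  then show ?thesis using intercept_le_one[of s] by (simp add: intercept_def[of r] left D_left)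
next
  case False
  have "r * D r \<le> r * D s" using False D_mono[OF assms] by (intro mult_left_mono) auto
  then show ?thesis using subgradient[of s r] by (simp add: intercept_def algebra_simps)
qed

lemma measurable_H [measurable]: "H \<in> borel_measurable borel"
  by (intro borel_measurable_continuous_onI continuous_H)

lemma measurable_D [measurable]: "D \<in> borel_measurable borel"
  by (intro borel_measurable_mono left_slope_mono convex)

lemma measurable_intercept [measurable]: "intercept \<in> borel_measurable borel"
  unfolding intercept_def by measurable

lemma countable_discont: "countable {r. \<not> isCont D r}"
  by (intro mono_ctble_discont left_slope_mono convex)

lemma H_deriv: "isCont D r \<Longrightarrow> (H has_real_derivative D r) (at r)"
  by (rule left_slope_has_real_derivative[OF convex])

end

lemma tail_dep_mono_right:
  assumes "pickands A" "0 < u" "0 < v" "v \<le> v'"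
  shows "tail_dep A u v \<le> tail_dep A u v'"
proof -
  interpret stable_section "tail_section A" by (rule stable_section_tail_section) fact
  show ?thesis
    using assms by (simp add: tail_dep_eq_tail_section mult_left_mono H_mono divide_right_mono)
qed

text \<open>
  A convex function that starts at its minimum increases strictly once it has left it; in the first
  argument the minimum of the tail dependence function is \<open>v\<close>.
\<close>
lemma tail_dep_strict_mono_left:
  assumes "pickands A" "0 < u" "u < u'" "0 < v" "v < tail_dep A u' v"
  shows "tail_dep A u v < tail_dep A u' v"
proof -
  let ?B = "\<lambda>t. A (1 - t)"
  interpret stable_section "tail_section ?B"
    by (intro stable_section_tail_section pickands_reflect) fact
  have eq: "tail_dep A w v = v * tail_section ?B (w / v)" if "0 < w" for w
    using that assms tail_dep_reflect[of w v A] tail_dep_eq_tail_section[of v w ?B] by simp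
  have "tail_section ?B (u / v) < tail_section ?B (u' / v)"
    using assms eq[of u'] by (intro strict_mono_above_one) (auto simp: divide_strict_right_mono)
  then show ?thesis using assms eq[of u] eq[of u'] by simp
qed

section \<open>A random vector whose distribution function is the copula\<close>

text \<open>The extreme-value copula in terms of the section of its tail dependence function.\<close>
definition section_copula :: "(real \<Rightarrow> real) \<Rightarrow> real \<Rightarrow> real \<Rightarrow> real" where
  "section_copula H = extend_copula (\<lambda>x y. exp (ln x * H (ln y / ln x)))"

lemma ev_copula_eq_section_copula:
  assumes "pickands A" "x \<in> {0..1}" "y \<in> {0..1}"
  shows "ev_copula A x y = section_copula (tail_section A) x y"
proof -
  have "(x * y) powr A (ln x / ln (x * y)) = exp (ln x * tail_section A (ln y / ln x))"
    if "0 < x" "x < 1" "0 < y" "y < 1"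
  proof -
    have "ln x < 0" "ln y < 0" using that by auto
    have "tail_dep A (- ln x) (- ln y) = - ln x * tail_section A (ln y / ln x)"
      using tail_dep_eq_tail_section[of "- ln x" "- ln y" A] that by simp
    moreover have "- ln x / (- ln x + - ln y) = ln x / ln (x * y)"
      using that minus_divide_divide[of "ln x" "ln x + ln y"] by (simp add: ln_mult_pos)
    ultimately have "ln (x * y) * A (ln x / ln (x * y)) = ln x * tail_section A (ln y / ln x)"
      using that by (simp add: tail_dep_def ln_mult algebra_simps)
    then show ?thesis using that by (simp add: powr_def mult.commute)
  qed
  then show ?thesis using assms by (auto simp: ev_copula_def section_copula_def extend_copula_def)
qed

definition unit_lebesgue :: "real measure" where
  "unit_lebesgue = density lborel (indicator {0<..<1})"

lemma space_unit_lebesgue [simp]: "space unit_lebesgue = UNIV"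
  by (simp add: unit_lebesgue_def)

lemma sets_unit_lebesgue [simp, measurable_cong]: "sets unit_lebesgue = sets borel"
  by (simp add: unit_lebesgue_def)

lemma nn_integral_unit_lebesgue:
  assumes [measurable]: "f \<in> borel_measurable borel"
  shows "(\<integral>\<^sup>+x. f x \<partial>unit_lebesgue) = (\<integral>\<^sup>+x. f x * indicator {0<..<1} x \<partial>lborel)"
  unfolding unit_lebesgue_def by (subst nn_integral_density) (auto simp: mult.commute)

lemma AE_unit_lebesgue: "AE x in unit_lebesgue. 0 < x \<and> x < 1"
  unfolding unit_lebesgue_def by (subst AE_density) (auto simp: indicator_def)

lemma emeasure_unit_lebesgue_atMost:
  assumes "0 \<le> c" "c \<le> 1" shows "emeasure unit_lebesgue {..c} = ennreal c"
proof -
  have "emeasure unit_lebesgue {..c} = (\<integral>\<^sup>+x. indicator {..c} x * indicator {0<..<1} x \<partial>lborel)"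
    using nn_integral_unit_lebesgue[of "indicator {..c}"] by simp
  also have "\<dots> = (\<integral>\<^sup>+x. indicator {0..c} x \<partial>lborel)"
    by (rule nn_integral_cong_AE, use AE_lborel_singleton[of 0] AE_lborel_singleton[of 1] in eventually_elim)
      (use assms in \<open>auto simp: indicator_def\<close>)
  finally show ?thesis using assms by simp
qed

lemma emeasure_unit_lebesgue_UNIV: "emeasure unit_lebesgue UNIV = 1"
  using nn_integral_unit_lebesgue[of "\<lambda>_. 1"] by simp

interpretation unit_lebesgue: finite_measure unit_lebesgue
  by (rule finite_measureI) (simp add: emeasure_unit_lebesgue_UNIV)

interpretation unit_lebesgue_lborel: pair_sigma_finite unit_lebesgue "lborel :: real measure" ..

lemma nn_integral_neg_ln_powr:
  assumes "2 \<le> m"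
  shows "(\<integral>\<^sup>+s. ennreal (- ln s * s powr (m - 1)) \<partial>unit_lebesgue) = ennreal (1 / m\<^sup>2)"
proof -
  define F where "F s = s powr m / m\<^sup>2 - s powr m * ln s / m" for s
  have "((\<lambda>s. s powr m / m\<^sup>2 - s powr m * ln s / m) \<longlongrightarrow> 0) (at_right 0)"
    using assms by real_asymp
  then have lim0: "(F \<longlongrightarrow> F 0) (at_right 0)" by (simp add: F_def[abs_def])
  have "continuous_on {0..1} F"
    unfolding continuous_on_eq_continuous_within
  proof
    fix x :: real assume x: "x \<in> {0..1}"
    show "continuous (at x within {0..1}) F"
    proof (cases "x = 0")
      case True
      then show ?thesis using lim0 by (simp add: continuous_within at_within_Icc_at_right)
    next
      case False
      then have "isCont F x"
        using x assms unfolding F_def[abs_def] by (intro continuous_intros) auto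
      then show ?thesis by (rule continuous_at_imp_continuous_at_within)
    qed
  qed
  moreover have "(F has_real_derivative (- ln s * s powr (m - 1))) (at s)" if "0 < s" "s < 1" for s
  proof -
    have d: "((\<lambda>s. s powr m) has_real_derivative m * s powr (m - 1)) (at s)"
      using that by (auto intro!: has_real_derivative_powr)
    have "(F has_real_derivative m * s powr (m - 1) / m\<^sup>2 -
        (m * s powr (m - 1) * ln s + inverse s * s powr m) / m) (at s)"
      unfolding F_def
      using that by (intro DERIV_diff DERIV_cdivide DERIV_mult d DERIV_ln)
    moreover have "inverse s * s powr m = s powr (m - 1)"
      using that by (simp add: powr_diff divide_inverse mult.commute)
    moreover have "m * q / m\<^sup>2 - (m * q * l + q) / m = - l * q" for q l :: real
      using assms by (simp add: field_simps power2_eq_square)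
    ultimately show ?thesis by simp
  qed
  moreover have "0 \<le> - ln s * s powr (m - 1) \<and> - ln s * s powr (m - 1) \<le> 1" if "0 < s" "s < 1" for s
  proof
    show "0 \<le> - ln s * s powr (m - 1)" using that by (simp add: mult_nonpos_nonneg)
    have "- ln s * s powr (m - 1) \<le> - ln s * s powr 1"
      using that assms by (intro mult_left_mono powr_mono') auto
    also have "\<dots> \<le> 1"
      using that ln_le_minus_one[of "1 / s"] by (simp add: ln_div field_simps)
    finally show "- ln s * s powr (m - 1) \<le> 1" .
  qed
  moreover have "isCont (\<lambda>s. - ln s * s powr (m - 1)) s" if "0 < s" for s
    using that by (intro continuous_intros) auto
  ultimately have "(\<integral>\<^sup>+s. ennreal (- ln s * s powr (m - 1)) * indicator {0<..<1} s \<partial>lborel) =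
      ennreal (F 1 - F 0)"
    by (intro nn_integral_FTC_off_countable[where S = "{}" and B = 1]) auto
  then show ?thesis by (subst nn_integral_unit_lebesgue) (auto simp: F_def)
qed

context stable_section
begin

text \<open>
  For \<open>(X, Y)\<close> distributed according to the copula, the conditional probability of
  \<open>- ln Y \<ge> u r\<close> given \<open>- ln X = u\<close>. Using the ratio \<open>r\<close> instead of \<open>Y\<close> keeps \<open>u\<close> and the section
  apart, so that the integration over \<open>u\<close> can be carried out explicitly.
\<close>
definition survival :: "real \<Rightarrow> real \<Rightarrow> real" where
  "survival u r = exp (u - u * H r) * intercept r"

lemma survival_nonneg: "0 \<le> survival u r"
  by (simp add: survival_def intercept_nonneg)

lemma survival_left: "r \<le> 0 \<Longrightarrow> survival u r = 1"
  by (simp add: survival_def intercept_def left D_left)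

lemma survival_antimono:
  assumes "0 \<le> u" "r \<le> s" shows "survival u s \<le> survival u r"
  unfolding survival_def
  using assms H_mono[OF assms(2)] intercept_antimono[OF assms(2)]
  by (intro mult_mono) (auto simp: intercept_nonneg mult_left_mono)

lemma survival_le_one: "0 \<le> u \<Longrightarrow> survival u r \<le> 1"
  using survival_antimono[of u "min r 0" r] survival_left[of "min r 0" u] by simp

lemma survival_le_exp:
  assumes "0 \<le> u" shows "survival u r \<le> exp (u - u * r)"
proof -
  have "survival u r \<le> exp (u - u * r) * 1"
    unfolding survival_def using assms ge_self[of r]
    by (intro mult_mono) (auto simp: intercept_nonneg intercept_le_one mult_left_mono)
  then show ?thesis by simp
qed

lemma survival_left_continuous: "((\<lambda>r. survival u r) \<longlongrightarrow> survival u r) (at_left r)"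
proof -
  have "(H \<longlongrightarrow> H r) (at_left r)" using cont[of r] by (auto simp: isCont_def intro: tendsto_within_subset)
  then show ?thesis
    unfolding survival_def intercept_def
    by (intro tendsto_intros left_slope_left_continuous convex)
qed

definition ratio :: "real \<Rightarrow> real \<Rightarrow> real" where
  "ratio u p = Sup {r. p \<le> survival u r}"

text \<open>
  The generalised inverse of the survival function in \<open>r\<close>. Left continuity gives the equivalence
  with no exceptional values.
\<close>
lemma le_ratio_iff:
  assumes "0 < u" "0 < p" "p < 1"
  shows "r \<le> ratio u p \<longleftrightarrow> p \<le> survival u r"
proof -
  let ?S = "{r. p \<le> survival u r}"
  have ne: "0 \<in> ?S" using assms survival_left[of 0 u] by simp
  have bdd: "bdd_above ?S"
  proof (rule bdd_aboveI)
    fix r assume "r \<in> ?S"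
    then have "p \<le> exp (u - u * r)" using survival_le_exp[of u r] assms by simp
    then have "ln p \<le> u - u * r" using assms ln_le_cancel_iff[of p "exp (u - u * r)"] by simp
    then show "r \<le> (u - ln p) / u" using assms by (simp add: field_simps)
  qed
  have below: "p \<le> survival u s" if "s < ratio u p" for s
  proof -
    have "?S \<noteq> {}" using ne by blast
    then have "\<exists>t\<in>?S. s < t" using that unfolding ratio_def by (rule less_cSupD)
    then obtain t where "t \<in> ?S" "s < t" ..
    then show ?thesis using survival_antimono[of u s t] assms by auto
  qed
  have "p \<le> survival u (ratio u p)"
    by (rule tendsto_lowerbound[OF survival_left_continuous])
      (auto intro!: eventually_at_leftI[of "ratio u p - 1"] below)
  then have "p \<le> survival u r" if "r \<le> ratio u p"
    using survival_antimono[OF _ that, of u] assms by simp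
  moreover have "r \<le> ratio u p" if "p \<le> survival u r"
    unfolding ratio_def using that bdd by (intro cSup_upper) auto
  ultimately show ?thesis by blast
qed

lemma ratio_nonneg: "0 < u \<Longrightarrow> 0 < p \<Longrightarrow> p < 1 \<Longrightarrow> 0 \<le> ratio u p"
  by (simp add: le_ratio_iff survival_left)

text \<open>
  The parameters \<open>s\<close> and \<open>p\<close> are the values of two independent uniform variables; outside the open unit
  square, which has full measure, the value is arbitrary and chosen to keep the function measurable.
\<close>
definition vector_ratio :: "real \<Rightarrow> real \<Rightarrow> real" where
  "vector_ratio s p = (if 0 < s \<and> s < 1 \<and> 0 < p \<and> p < 1 then ratio (- ln s) p else 0)"

lemma measurable_vector_ratio [measurable]:
  "(\<lambda>w. vector_ratio (fst w) (snd w)) \<in> borel_measurable (borel \<Otimes>\<^sub>M borel)"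
  unfolding borel_measurable_iff_ge
proof
  fix a
  have "{w \<in> space (borel \<Otimes>\<^sub>M borel). a \<le> vector_ratio (fst w) (snd w)} =
    {w \<in> space (borel \<Otimes>\<^sub>M borel). if 0 < fst w \<and> fst w < 1 \<and> 0 < snd w \<and> snd w < 1
       then snd w \<le> survival (- ln (fst w)) a else a \<le> 0}"
    by (auto simp: vector_ratio_def le_ratio_iff)
  also have "\<dots> \<in> sets (borel \<Otimes>\<^sub>M borel)" unfolding survival_def by measurable
  finally show "{w \<in> space (borel \<Otimes>\<^sub>M borel). a \<le> vector_ratio (fst w) (snd w)} \<in> sets (borel \<Otimes>\<^sub>M borel)" .
qed

lemma vector_ratio_nonneg: "0 \<le> vector_ratio s p"
  by (simp add: vector_ratio_def ratio_nonneg)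

definition copula_vector :: "real \<Rightarrow> real \<Rightarrow> real \<times> real" where
  "copula_vector s p =
     (if 0 < s \<and> s < 1 then (s, exp (ln s * vector_ratio s p)) else (0, 0))"

text \<open>
  The integrand is the derivative of \<open>s \<mapsto> C(s, y)\<close> away from countably many points.
\<close>
lemma nn_integral_conditional:
  assumes "0 \<le> x" "x \<le> 1" "0 < y" "y < 1"
  shows "(\<integral>\<^sup>+s. ennreal (survival (- ln s) (ln y / ln s)) * indicator {..x} s \<partial>unit_lebesgue) =
    ennreal (section_copula H x y)"
proof -
  define L where "L = ln y"
  have L: "L < 0" using assms by (simp add: L_def)
  let ?f = "\<lambda>s. survival (- ln s) (L / ln s)"
  define F where "F s = section_copula H s y" for s
  have F: "F s = exp (ln s * H (L / ln s))" if "0 < s" "s < 1" for s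
    using that assms by (simp add: F_def section_copula_def extend_copula_def L_def)
  have F_le: "F s \<le> s" if "0 < s" "s < 1" for s
  proof -
    have "ln s * H (L / ln s) \<le> ln s * 1"
      using that ge_one by (intro mult_left_mono_neg) auto
    then have "exp (ln s * H (L / ln s)) \<le> exp (ln s)" by simp
    then show ?thesis using that F by simp
  qed
  have F_bnd: "s * y \<le> F s \<and> F s \<le> y" if "0 < s" "s < 1" for s
  proof -
    have r: "0 \<le> L / ln s" using that L by (simp add: divide_nonpos_neg)
    have "ln s * H (L / ln s) \<le> ln s * (L / ln s)"
      using that ge_self by (intro mult_left_mono_neg) auto
    moreover have "ln s * (1 + L / ln s) \<le> ln s * H (L / ln s)"
      using that bounds[OF r] by (intro mult_left_mono_neg) auto
    moreover have "ln s * (1 + L / ln s) = ln s + L" "ln s * (L / ln s) = L"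
      using that by (auto simp: field_simps)
    ultimately have "exp (ln s + L) \<le> F s" "F s \<le> exp L" using F[OF that] by auto
    moreover have "exp (ln s + L) = s * y" "exp L = y" using that assms by (auto simp: L_def exp_add)
    ultimately show ?thesis by simp
  qed
  \<comment> \<open>The points \<open>s\<close> whose ratio \<open>L / ln s\<close> is a kink of \<open>H\<close>.\<close>
  define S where "S = (\<lambda>r. exp (L / r)) ` {r. \<not> isCont D r}"
  have S: "countable S" unfolding S_def by (intro countable_image countable_discont)
  have D_cont: "isCont D (L / ln s)" if "s \<in> {0<..<x} - S" for s
  proof (rule ccontr)
    assume "\<not> isCont D (L / ln s)"
    moreover have "s = exp (L / (L / ln s))" using that L assms by simp
    ultimately have "s \<in> S" unfolding S_def by blast
    then show False using that by simp
  qed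
  have der: "(F has_real_derivative ?f s) (at s)" if s: "s \<in> {0<..<x} - S" for s
  proof -
    have s01: "0 < s" "s < 1" "ln s < 0" using s assms by auto
    let ?r = "L / ln s"
    have "((\<lambda>s. L / ln s) has_real_derivative (- L / (s * (ln s)\<^sup>2))) (at s)"
      using s01 by (auto intro!: derivative_eq_intros simp: field_simps power2_eq_square)
    from DERIV_chain2[OF H_deriv[OF D_cont[OF s]] this]
    have "((\<lambda>s. H (L / ln s)) has_real_derivative (D ?r * (- L / (s * (ln s)\<^sup>2)))) (at s)" .
    then have "((\<lambda>s. exp (ln s * H (L / ln s))) has_real_derivative
        exp (ln s * H ?r) * (1 / s * H ?r + ln s * (D ?r * (- L / (s * (ln s)\<^sup>2))))) (at s)"
      using s01 by (auto intro!: derivative_eq_intros)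
    moreover have "1 / s * H ?r + ln s * (D ?r * (- L / (s * (ln s)\<^sup>2))) = intercept ?r / s"
      using s01 by (simp add: intercept_def field_simps power2_eq_square)
    moreover have "exp (ln s * H ?r) * (intercept ?r / s) = ?f s"
      using s01 by (simp add: survival_def exp_diff exp_minus field_simps exp_add)
    ultimately have "((\<lambda>s. exp (ln s * H (L / ln s))) has_real_derivative ?f s) (at s)" by simp
    moreover have "\<forall>\<^sub>F t in nhds s. F t = exp (ln t * H (L / ln t))"
      using s01 eventually_nhds_in_open[of "{0<..<1}" s] by (auto elim!: eventually_mono simp: F)
    ultimately show ?thesis by (subst DERIV_cong_ev[OF refl _ refl])
  qed
  have f_cont: "isCont ?f s" if s: "s \<in> {0<..<x} - S" for s
  proof -
    have s01: "0 < s" "s < 1" "ln s \<noteq> 0" using s assms by auto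
    have q: "isCont (\<lambda>s. L / ln s) s" using s01 by (intro continuous_intros) auto
    have qH: "isCont (\<lambda>s. H (L / ln s)) s" by (rule isCont_o2[OF q cont])
    have qD: "isCont (\<lambda>s. D (L / ln s)) s" by (rule isCont_o2[OF q D_cont[OF s]])
    have ln: "isCont ln s" using s01 by (intro isCont_ln) auto
    show ?thesis
      unfolding survival_def intercept_def
      by (intro isCont_mult isCont_diff isCont_minus continuous_exp ln q qH qD)
  qed
  have cont_F: "continuous_on {0..x} F"
  proof -
    have "continuous (at s within {0..1}) F" if s: "s \<in> {0..1}" for s
    proof -
      consider "s = 0" | "s = 1" | "0 < s" "s < 1" using s by fastforce
      then show ?thesis
      proof cases
        case 1
        have "(F \<longlongrightarrow> 0) (at_right 0)"
        proof (rule tendsto_sandwich[of "\<lambda>_. 0" F _ "\<lambda>s. s"])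
          show "\<forall>\<^sub>F s in at_right 0. 0 \<le> F s"
            by (rule eventually_at_rightI[of 0 1]) (auto simp: F)
          show "\<forall>\<^sub>F s in at_right 0. F s \<le> s"
            by (rule eventually_at_rightI[of 0 1]) (auto simp: F_le)
        qed (auto intro!: tendsto_eq_intros)
        moreover have "F 0 = 0" by (simp add: F_def section_copula_def extend_copula_def)
        ultimately show ?thesis using 1 by (simp add: continuous_within at_within_Icc_at_right)
      next
        case 2
        have "(F \<longlongrightarrow> y) (at_left 1)"
        proof (rule tendsto_sandwich[of "\<lambda>s. s * y" F _ "\<lambda>_. y"])
          show "\<forall>\<^sub>F s in at_left 1. s * y \<le> F s"
            by (rule eventually_at_leftI[of 0]) (auto simp: F_bnd)
          show "\<forall>\<^sub>F s in at_left 1. F s \<le> y"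
            by (rule eventually_at_leftI[of 0]) (auto simp: F_bnd)
        qed (auto intro!: tendsto_eq_intros)
        moreover have "F 1 = y" using assms by (simp add: F_def section_copula_def extend_copula_def)
        ultimately show ?thesis using 2 by (simp add: continuous_within at_within_Icc_at_left)
      next
        case 3
        have q: "isCont (\<lambda>s. L / ln s) s" using 3 by (intro continuous_intros) auto
        have "isCont (\<lambda>s. H (L / ln s)) s" by (rule isCont_o2[OF q cont])
        then have "isCont (\<lambda>s. exp (ln s * H (L / ln s))) s"
          using 3 by (intro isCont_mult continuous_exp isCont_ln) auto
        moreover have "\<forall>\<^sub>F t in nhds s. F t = exp (ln t * H (L / ln t))"
          using 3 eventually_nhds_in_open[of "{0<..<1}" s] by (auto elim!: eventually_mono simp: F)
        ultimately have "isCont F s" by (simp add: isCont_cong)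
        then show ?thesis by (rule continuous_at_imp_continuous_at_within)
      qed
    qed
    then have "continuous_on {0..1} F" by (simp add: continuous_on_eq_continuous_within)
    then show ?thesis using assms by (auto intro: continuous_on_subset)
  qed
  have [measurable]: "?f \<in> borel_measurable borel" unfolding survival_def by measurable
  have "(\<integral>\<^sup>+s. ennreal (?f s) * indicator {..x} s \<partial>unit_lebesgue) =
      (\<integral>\<^sup>+s. ennreal (?f s) * indicator {..x} s * indicator {0<..<1} s \<partial>lborel)"
    by (rule nn_integral_unit_lebesgue) measurable
  also have "\<dots> = (\<integral>\<^sup>+s. ennreal (?f s) * indicator {0<..<x} s \<partial>lborel)"
    by (rule nn_integral_cong_AE, use AE_lborel_singleton[of x] AE_lborel_singleton[of 1] in eventually_elim)
      (use assms in \<open>auto simp: indicator_def\<close>)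
  also have "\<dots> = ennreal (F x - F 0)"
    using survival_nonneg survival_le_one assms(1,2)
    by (intro nn_integral_FTC_off_countable[OF assms(1) cont_F S _ _ der f_cont, where B = 1]) auto
  finally show ?thesis
    by (simp add: F_def L_def) (simp add: section_copula_def extend_copula_def)
qed

abbreviation "unit_square_lebesgue \<equiv> unit_lebesgue \<Otimes>\<^sub>M unit_lebesgue"

definition copula_law :: "(real \<times> real) measure" where
  "copula_law = distr unit_square_lebesgue (restrict_space borel ({0..1} \<times> {0..1}))
     (\<lambda>w. copula_vector (fst w) (snd w))"

lemma copula_vector_in_square: "copula_vector s p \<in> {0..1} \<times> {0..1}"
  using vector_ratio_nonneg[of s p] by (auto simp: copula_vector_def mult_nonpos_nonneg)

lemma measurable_copula_vector [measurable]:
  "(\<lambda>w. copula_vector (fst w) (snd w)) \<in> borel_measurable (borel \<Otimes>\<^sub>M borel)"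
  unfolding copula_vector_def by measurable

lemma measurable_copula_vector_square:
  "(\<lambda>w. copula_vector (fst w) (snd w)) \<in>
     measurable unit_square_lebesgue (restrict_space borel ({0..1} \<times> {0..1}))"
  using copula_vector_in_square by (intro measurable_restrict_space2) auto

lemma emeasure_conditional:
  assumes "0 < s" "s < 1" "0 < y" "y \<le> 1"
  shows "emeasure unit_lebesgue {p. copula_vector s p \<in> {0..x} \<times> {0..y}} =
    ennreal (survival (- ln s) (ln y / ln s)) * indicator {..x} s"
proof (cases "s \<le> x")
  case True
  have iff: "copula_vector s p \<in> {0..x} \<times> {0..y} \<longleftrightarrow> p \<le> survival (- ln s) (ln y / ln s)"
    if "0 < p \<and> p < 1" for p
  proof -
    have "exp (ln s * vector_ratio s p) \<le> y \<longleftrightarrow> ln s * vector_ratio s p \<le> ln y"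
      using assms by (metis exp_le_cancel_iff exp_ln)
    also have "\<dots> \<longleftrightarrow> ln y / ln s \<le> ratio (- ln s) p"
      using assms that by (simp add: vector_ratio_def divide_le_eq mult.commute)
    also have "\<dots> \<longleftrightarrow> p \<le> survival (- ln s) (ln y / ln s)"
      using assms that by (simp add: le_ratio_iff)
    finally show ?thesis using True assms by (simp add: copula_vector_def)
  qed
  have "emeasure unit_lebesgue {p. copula_vector s p \<in> {0..x} \<times> {0..y}} =
      emeasure unit_lebesgue {..survival (- ln s) (ln y / ln s)}"
  proof (rule emeasure_eq_AE)
    show "AE p in unit_lebesgue. p \<in> {p. copula_vector s p \<in> {0..x} \<times> {0..y}} \<longleftrightarrow>
        p \<in> {..survival (- ln s) (ln y / ln s)}"
      using AE_unit_lebesgue by eventually_elim (use iff in auto)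
    have [measurable]: "(\<lambda>p. copula_vector s p) \<in> borel_measurable borel"
      using measurable_compose[OF _ measurable_copula_vector, of "\<lambda>p. (s, p)" borel] by simp
    have "{p \<in> space borel. copula_vector s p \<in> {0..x} \<times> {0..y}} \<in> sets borel"
      using measurable_sets[of "copula_vector s" borel borel "{0..x} \<times> {0..y}"]
      by (simp add: borel_Times vimage_def)
    then show "{p. copula_vector s p \<in> {0..x} \<times> {0..y}} \<in> sets unit_lebesgue"
      by simp
  qed simp
  also have "\<dots> = ennreal (survival (- ln s) (ln y / ln s))"
    using assms by (intro emeasure_unit_lebesgue_atMost survival_nonneg survival_le_one) auto
  finally show ?thesis using True by simp
next
  case False
  then have "{p. copula_vector s p \<in> {0..x} \<times> {0..y}} = {}" using assms by (auto simp: copula_vector_def)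
  then show ?thesis using False by simp
qed

lemma emeasure_copula_law:
  assumes "x \<in> {0..1}" "y \<in> {0..1}"
  shows "emeasure copula_law ({0..x} \<times> {0..y}) = ennreal (section_copula H x y)"
proof -
  let ?R = "{0..x} \<times> {0..y}"
  have R: "?R \<in> sets (restrict_space borel ({0..1} \<times> {0..1}))"
    using assms by (subst sets_restrict_space_iff) (auto simp: borel_Times)
  have V: "{w. copula_vector (fst w) (snd w) \<in> ?R} \<in> sets unit_square_lebesgue"
    using measurable_sets[OF measurable_copula_vector_square R] by (simp add: space_pair_measure vimage_def)
  have "emeasure copula_law ?R =
      emeasure unit_square_lebesgue {w. copula_vector (fst w) (snd w) \<in> ?R}"
    unfolding copula_law_def using R
    by (subst emeasure_distr[OF measurable_copula_vector_square])
      (auto simp: space_pair_measure vimage_def)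
  also have "\<dots> = (\<integral>\<^sup>+s. emeasure unit_lebesgue {p. copula_vector s p \<in> ?R} \<partial>unit_lebesgue)"
    using V by (subst unit_lebesgue.emeasure_pair_measure_alt) (auto simp: vimage_def)
  also have "\<dots> = ennreal (section_copula H x y)"
  proof -
    consider "y = 0" | "y = 1" | "0 < y" "y < 1" using assms by fastforce
    then show ?thesis
    proof cases
      case 1
      have "(\<integral>\<^sup>+s. emeasure unit_lebesgue {p. copula_vector s p \<in> ?R} \<partial>unit_lebesgue) =
          (\<integral>\<^sup>+s. 0 \<partial>unit_lebesgue)"
        by (rule nn_integral_cong_AE, use AE_unit_lebesgue in eventually_elim)
          (use 1 in \<open>simp add: copula_vector_def\<close>)
      then show ?thesis using 1 by (simp add: section_copula_def extend_copula_def)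
    next
      case 2
      have "(\<integral>\<^sup>+s. emeasure unit_lebesgue {p. copula_vector s p \<in> ?R} \<partial>unit_lebesgue) =
          (\<integral>\<^sup>+s. indicator {..x} s \<partial>unit_lebesgue)"
        by (rule nn_integral_cong_AE, use AE_unit_lebesgue in eventually_elim)
          (use emeasure_conditional[of _ y x] 2 in \<open>simp add: survival_left\<close>)
      also have "\<dots> = ennreal x"
        using assms emeasure_unit_lebesgue_atMost[of x] by simp
      finally show ?thesis using 2 by (simp add: section_copula_def extend_copula_def)
    next
      case 3
      have "(\<integral>\<^sup>+s. emeasure unit_lebesgue {p. copula_vector s p \<in> ?R} \<partial>unit_lebesgue) =
          (\<integral>\<^sup>+s. ennreal (survival (- ln s) (ln y / ln s)) * indicator {..x} s \<partial>unit_lebesgue)"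
        by (rule nn_integral_cong_AE, use AE_unit_lebesgue in eventually_elim)
          (use emeasure_conditional[of _ y x] 3 in simp)
      then show ?thesis using nn_integral_conditional[of x y] assms 3 by simp
    qed
  qed
  finally show ?thesis .
qed

text \<open>
  With \<open>\<ell>(\<theta>) = ln (H (exp \<theta>))\<close> and \<open>r = exp \<theta>\<close> this is \<open>\<ell>'(\<theta>) (1 - \<ell>'(\<theta>)) / r\<close>.
\<close>
definition tau_density :: "real \<Rightarrow> real" where
  "tau_density r = D r * intercept r / (H r)\<^sup>2"

lemma tau_density_nonneg: "0 \<le> tau_density r"
  by (simp add: tau_density_def D_nonneg intercept_nonneg)

lemma measurable_tau_density [measurable]: "tau_density \<in> borel_measurable borel"
  unfolding tau_density_def by measurable

text \<open>
  This writes the value \<open>exp (- u H T)\<close> of the copula at a random point as an integral over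
  \<open>r \<le> T\<close>. Taking expectations then only needs the probabilities of these events, which are
  the values of the survival function.
\<close>
lemma nn_integral_ratio_tail:
  assumes "0 < u" "0 \<le> T"
  shows "ennreal (exp (- u * H T)) +
    (\<integral>\<^sup>+r. ennreal (u * D r * exp (- u * H r)) * indicator {..T} r \<partial>lborel) = ennreal (exp (- u))"
proof -
  have "(\<integral>\<^sup>+r. ennreal (u * D r * exp (- u * H r)) * indicator {..T} r \<partial>lborel) =
      (\<integral>\<^sup>+r. ennreal (u * D r * exp (- u * H r)) * indicator {0<..<T} r \<partial>lborel)"
    by (rule nn_integral_cong_AE, use AE_lborel_singleton[of T] in eventually_elim)
      (use D_left in \<open>auto simp: indicator_def\<close>)
  also have "\<dots> = ennreal (- exp (- u * H T) - - exp (- u * H 0))"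
  proof (rule nn_integral_FTC_off_countable[OF assms(2) _ countable_discont, where B = u])
    show "continuous_on {0..T} (\<lambda>r. - exp (- u * H r))"
      by (intro continuous_intros continuous_H)
    show "0 \<le> u * D r * exp (- u * H r) \<and> u * D r * exp (- u * H r) \<le> u" for r
    proof
      show "0 \<le> u * D r * exp (- u * H r)" using assms D_nonneg[of r] by simp
      have "u * D r * exp (- u * H r) \<le> u * 1 * 1"
        using assms D_nonneg[of r] D_le_one[of r] pos[of r] by (intro mult_mono) auto
      then show "u * D r * exp (- u * H r) \<le> u" by simp
    qed
    fix r assume "r \<in> {0<..<T} - {r. \<not> isCont D r}"
    then have r: "isCont D r" by simp
    show "((\<lambda>r. - exp (- u * H r)) has_real_derivative u * D r * exp (- u * H r)) (at r)"
      using H_deriv[OF r] by (auto intro!: derivative_eq_intros)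
    show "isCont (\<lambda>r. u * D r * exp (- u * H r)) r"
      by (intro continuous_intros continuous_exp r cont)
  qed measurable
  also have "\<dots> = ennreal (exp (- u) - exp (- u * H T))" by (simp add: left)
  finally show ?thesis
    using assms ge_one[of T] by (simp flip: ennreal_plus)
qed

lemma section_copula_vector:
  assumes "0 < s" "s < 1"
  shows "section_copula H s (exp (ln s * vector_ratio s p)) = exp (ln s * H (vector_ratio s p))"
  using assms vector_ratio_nonneg[of s p] left[of 0]
  by (auto simp: section_copula_def extend_copula_def)

text \<open>
  The first summand is the integral of the copula with respect to its own measure. After the
  expectation over \<open>p\<close>, the integral over \<open>s\<close> is elementary and contributes \<open>1 / (2 H)\<^sup>2\<close> at each
  \<open>r\<close>; the value \<open>1 / 2\<close> is the integral of \<open>s\<close>.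
\<close>
lemma nn_integral_section_copula:
  "(\<integral>\<^sup>+s. \<integral>\<^sup>+p. ennreal (exp (ln s * H (vector_ratio s p))) \<partial>unit_lebesgue \<partial>unit_lebesgue) +
   (\<integral>\<^sup>+r. ennreal (tau_density r) \<partial>lborel) / 4 = 1 / 2"
proof -
  let ?f = "\<lambda>s r. ennreal (- ln s * D r * exp (ln s * H r))"
  have inner: "(\<integral>\<^sup>+p. ennreal (exp (ln s * H (vector_ratio s p))) \<partial>unit_lebesgue) +
      (\<integral>\<^sup>+r. ennreal (D r * intercept r) * ennreal (- ln s * s powr (2 * H r - 1)) \<partial>lborel) = ennreal s"
    if s: "0 < s \<and> s < 1" for s
  proof -
    let ?g = "\<lambda>p r. ?f s r * indicator {..vector_ratio s p} r"
    have [measurable]: "(\<lambda>p. vector_ratio s p) \<in> borel_measurable borel"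
      using measurable_compose[OF _ measurable_vector_ratio, of "\<lambda>p. (s, p)" borel] by simp
    have g [measurable]: "(\<lambda>(p, r). ?g p r) \<in> borel_measurable (unit_lebesgue \<Otimes>\<^sub>M lborel)"
      unfolding indicator_def atMost_iff by measurable
    have "ennreal s = (\<integral>\<^sup>+p. ennreal s \<partial>unit_lebesgue)"
      by (simp add: emeasure_unit_lebesgue_UNIV)
    also have "\<dots> = (\<integral>\<^sup>+p. ennreal (exp (ln s * H (vector_ratio s p))) + (\<integral>\<^sup>+r. ?g p r \<partial>lborel) \<partial>unit_lebesgue)"
      using nn_integral_ratio_tail[of "- ln s"] s vector_ratio_nonneg by simp
    also have "\<dots> = (\<integral>\<^sup>+p. ennreal (exp (ln s * H (vector_ratio s p))) \<partial>unit_lebesgue) +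
        (\<integral>\<^sup>+p. \<integral>\<^sup>+r. ?g p r \<partial>lborel \<partial>unit_lebesgue)"
      by (rule nn_integral_add) measurable
    also have "(\<integral>\<^sup>+p. \<integral>\<^sup>+r. ?g p r \<partial>lborel \<partial>unit_lebesgue) =
        (\<integral>\<^sup>+r. \<integral>\<^sup>+p. ?g p r \<partial>unit_lebesgue \<partial>lborel)"
      by (rule unit_lebesgue_lborel.Fubini'[symmetric, OF g])
    also have "\<dots> = (\<integral>\<^sup>+r. ennreal (D r * intercept r) * ennreal (- ln s * s powr (2 * H r - 1)) \<partial>lborel)"
    proof (rule nn_integral_cong)
      fix r
      have "(\<integral>\<^sup>+p. ?g p r \<partial>unit_lebesgue) =
          (\<integral>\<^sup>+p. ?f s r * indicator {..survival (- ln s) r} p \<partial>unit_lebesgue)"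
        by (rule nn_integral_cong_AE, use AE_unit_lebesgue in eventually_elim)
          (use s in \<open>simp add: indicator_def vector_ratio_def le_ratio_iff\<close>)
      also have "\<dots> = ?f s r * ennreal (survival (- ln s) r)"
        using s survival_nonneg survival_le_one
        by (simp add: nn_integral_cmult emeasure_unit_lebesgue_atMost)
      also have "\<dots> = ennreal (D r * intercept r * (- ln s * (exp (ln s * H r) * exp (- ln s + ln s * H r))))"
        using s by (simp add: survival_def mult_ac survival_nonneg D_nonneg intercept_nonneg
            flip: ennreal_mult')
      also have "exp (ln s * H r) * exp (- ln s + ln s * H r) = s powr (2 * H r - 1)"
        using s by (simp add: powr_def flip: exp_add) (simp add: algebra_simps)
      also have "ennreal (D r * intercept r * (- ln s * s powr (2 * H r - 1))) =
          ennreal (D r * intercept r) * ennreal (- ln s * s powr (2 * H r - 1))"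
        by (rule ennreal_mult') (simp add: D_nonneg intercept_nonneg)
      finally show "(\<integral>\<^sup>+p. ?g p r \<partial>unit_lebesgue) = \<dots>" .
    qed
    finally show ?thesis by simp
  qed
  let ?h = "\<lambda>s r. ennreal (D r * intercept r) * ennreal (- ln s * s powr (2 * H r - 1))"
  have h [measurable]: "(\<lambda>(s, r). ?h s r) \<in> borel_measurable (unit_lebesgue \<Otimes>\<^sub>M lborel)" by measurable
  have "(\<integral>\<^sup>+s. \<integral>\<^sup>+r. ?h s r \<partial>lborel \<partial>unit_lebesgue) = (\<integral>\<^sup>+r. \<integral>\<^sup>+s. ?h s r \<partial>unit_lebesgue \<partial>lborel)"
    by (rule unit_lebesgue_lborel.Fubini'[symmetric, OF h])
  also have "\<dots> = (\<integral>\<^sup>+r. ennreal (tau_density r) / 4 \<partial>lborel)"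
  proof (rule nn_integral_cong)
    fix r
    have "(\<integral>\<^sup>+s. ?h s r \<partial>unit_lebesgue) =
        ennreal (D r * intercept r) * (\<integral>\<^sup>+s. ennreal (- ln s * s powr (2 * H r - 1)) \<partial>unit_lebesgue)"
      by (rule nn_integral_cmult) measurable
    also have "\<dots> = ennreal (D r * intercept r) * ennreal (1 / (2 * H r)\<^sup>2)"
      using nn_integral_neg_ln_powr[of "2 * H r"] ge_one[of r] by simp
    also have "\<dots> = ennreal (tau_density r / 4)"
      by (simp add: tau_density_def power2_eq_square D_nonneg intercept_nonneg mult_ac flip: ennreal_mult')
    also have "\<dots> = ennreal (tau_density r) / 4"
      using divide_ennreal[of "tau_density r" 4] tau_density_nonneg[of r] by simp
    finally show "(\<integral>\<^sup>+s. ?h s r \<partial>unit_lebesgue) = ennreal (tau_density r) / 4" .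
  qed
  also have "\<dots> = (\<integral>\<^sup>+r. ennreal (tau_density r) \<partial>lborel) / 4"
    by (rule nn_integral_divide) measurable
  finally have density: "(\<integral>\<^sup>+r. ennreal (tau_density r) \<partial>lborel) / 4 = (\<integral>\<^sup>+s. \<integral>\<^sup>+r. ?h s r \<partial>lborel \<partial>unit_lebesgue)" ..
  have "(\<integral>\<^sup>+s. \<integral>\<^sup>+p. ennreal (exp (ln s * H (vector_ratio s p))) \<partial>unit_lebesgue \<partial>unit_lebesgue) +
      (\<integral>\<^sup>+r. ennreal (tau_density r) \<partial>lborel) / 4 =
      (\<integral>\<^sup>+s. (\<integral>\<^sup>+p. ennreal (exp (ln s * H (vector_ratio s p))) \<partial>unit_lebesgue) +
        (\<integral>\<^sup>+r. ?h s r \<partial>lborel) \<partial>unit_lebesgue)"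
    unfolding density
    by (rule nn_integral_add[symmetric])
      (auto intro!: unit_lebesgue.borel_measurable_nn_integral lborel.borel_measurable_nn_integral)
  also have "\<dots> = (\<integral>\<^sup>+s. ennreal s \<partial>unit_lebesgue)"
    by (rule nn_integral_cong_AE, use AE_unit_lebesgue in eventually_elim) (use inner in auto)
  also have "\<dots> = (\<integral>\<^sup>+s. ennreal s * indicator {0<..<1} s \<partial>lborel)"
    by (rule nn_integral_unit_lebesgue) measurable
  also have "\<dots> = ennreal (1\<^sup>2 / 2 - 0\<^sup>2 / 2)"
    by (rule nn_integral_FTC_off_countable[where S = "{}" and B = 1])
      (auto intro!: derivative_eq_intros continuous_intros)
  also have "\<dots> = 1 / 2"
    using divide_ennreal[of 1 2] by simp
  finally show ?thesis .
qed

text \<open>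
  Because the copula measure is determined by its values on rectangles, it is the law of the random
  vector, and the expectation of the copula is the one just computed.
\<close>
theorem kendall_tau_section:
  assumes C: "\<And>x y. x \<in> {0..1} \<Longrightarrow> y \<in> {0..1} \<Longrightarrow> C x y = section_copula H x y"
  shows "integrable lborel tau_density" "kendall_tau C = 1 - (LINT r|lborel. tau_density r)"
proof -
  let ?I = "\<integral>\<^sup>+r. ennreal (tau_density r) \<partial>lborel"
  let ?v = "\<lambda>w. copula_vector (fst w) (snd w)"
  let ?R = "restrict_space borel ({0..1} \<times> {0..1}) :: (real \<times> real) measure"
  define E where "E = (\<integral>\<^sup>+s. \<integral>\<^sup>+p. ennreal (exp (ln s * H (vector_ratio s p))) \<partial>unit_lebesgue \<partial>unit_lebesgue)"
  have half: "(1 / 2 :: ennreal) = ennreal (1 / 2)" using divide_ennreal[of 1 2] by simp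
  have sum: "E + ?I / 4 = ennreal (1 / 2)"
    unfolding E_def half[symmetric] by (rule nn_integral_section_copula)
  have fin: "E < \<infinity>" "?I / 4 < \<infinity>"
    using sum by (metis ennreal_add_eq_top ennreal_neq_top infinity_ennreal_def top.not_eq_extremum)+
  have I_fin: "?I < \<infinity>"
  proof (rule ccontr)
    assume "\<not> ?I < \<infinity>"
    then have "?I = top" by (simp add: less_top[symmetric])
    then show False using fin(2) by (simp add: divide_ennreal_def ennreal_top_mult)
  qed
  show int: "integrable lborel tau_density"
    using I_fin by (intro integrableI_nonneg) (auto simp: tau_density_nonneg)
  define K where "K = (LINT r|lborel. tau_density r)"
  have K: "0 \<le> K" "?I = ennreal K"
    unfolding K_def using int tau_density_nonneg by (auto simp: nn_integral_eq_integral)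
  have "?I / 4 = ennreal (K / 4)" using K divide_ennreal[of K 4] by simp
  moreover obtain e where e: "0 \<le> e" "E = ennreal e" using fin(1) by (cases E) auto
  ultimately have "ennreal (e + K / 4) = ennreal (1 / 2)"
    using sum K(1) by (simp only: ennreal_plus)
  then have "e + K / 4 = 1 / 2" using e K(1) by (subst (asm) ennreal_inj) auto
  then have E_K: "enn2real E + K / 4 = 1 / 2" using e by simp
  have meas: "copula_measure C = copula_law"
  proof (rule copula_measure_eqI)
    show "sets copula_law = sets ?R" by (simp add: copula_law_def)
  qed (use emeasure_copula_law C in auto)
  note v = measurable_copula_vector_square
  have sc [measurable]: "(\<lambda>(x, y). section_copula H x y) \<in> borel_measurable ?R"
    by (intro measurable_restrict_space1)
      (simp add: section_copula_def extend_copula_def split_beta' borel_prod[symmetric])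
  have "(LINT (x, y)|copula_measure C. C x y) = (LINT (x, y)|copula_law. section_copula H x y)"
    unfolding meas using C
    by (intro Bochner_Integration.integral_cong refl) (auto simp: copula_law_def space_restrict_space)
  also have "\<dots> = (LINT w|unit_square_lebesgue. case_prod (section_copula H) (?v w))"
    unfolding copula_law_def by (rule integral_distr[OF v sc])
  also have "\<dots> = enn2real (\<integral>\<^sup>+w. ennreal (case_prod (section_copula H) (?v w)) \<partial>unit_square_lebesgue)"
  proof (rule integral_eq_nn_integral)
    have "0 \<le> section_copula H x y" if "(x, y) \<in> {0..1} \<times> {0..1}" for x y
      using that by (auto simp: section_copula_def extend_copula_def)
    then show "AE w in unit_square_lebesgue. 0 \<le> case_prod (section_copula H) (?v w)"
      using copula_vector_in_square by (intro AE_I2) (metis (no_types, lifting) case_prod_beta' prod.collapse)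
  qed (rule measurable_compose[OF v sc])
  also have "(\<integral>\<^sup>+w. ennreal (case_prod (section_copula H) (?v w)) \<partial>unit_square_lebesgue) =
      (\<integral>\<^sup>+s. \<integral>\<^sup>+p. ennreal (case_prod (section_copula H) (copula_vector s p)) \<partial>unit_lebesgue \<partial>unit_lebesgue)"
    using measurable_compose[OF v sc] by (subst unit_lebesgue.nn_integral_fst[symmetric]) auto
  also have "\<dots> = E"
    unfolding E_def
    by (rule nn_integral_cong_AE, use AE_unit_lebesgue in eventually_elim)
      (auto simp: copula_vector_def section_copula_vector)
  finally show "kendall_tau C = 1 - (LINT r|lborel. tau_density r)"
    using E_K by (simp add: kendall_tau_def K_def)
qed

end

section \<open>Rescaling and positivity of the integral for Kendall's tau\<close>

text \<open>
  The density is \<open>q (1 - r q)\<close> for the logarithmic derivative \<open>q = D / H\<close>, and logarithmic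
  derivatives transform in a simple way under \<open>H\<^sub>1(r) powr \<gamma> = H\<^sub>2(r powr \<gamma>)\<close>.
\<close>
lemma tau_density_rescale:
  assumes "stable_section H1" "stable_section H2" and \<gamma>: "0 < \<gamma>"
    and rel: "\<And>r. 0 < r \<Longrightarrow> H1 r powr \<gamma> = H2 (r powr \<gamma>)"
    and r: "0 < r" and cont: "isCont (left_slope H1) r" "isCont (left_slope H2) (r powr \<gamma>)"
  shows "\<gamma> * stable_section.tau_density H1 r =
    \<bar>\<gamma> * r powr (\<gamma> - 1)\<bar> * stable_section.tau_density H2 (r powr \<gamma>)"
proof -
  interpret A: stable_section H1 by fact
  interpret B: stable_section H2 by fact
  define q where "q = r powr (\<gamma> - 1)"
  have q: "r powr \<gamma> = r * q" "0 < q" using r by (auto simp: q_def powr_diff)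
  have "((\<lambda>r. H1 r powr \<gamma>) has_real_derivative \<gamma> * H1 r powr (\<gamma> - 1) * A.D r) (at r)"
    using DERIV_chain2[OF has_real_derivative_powr[OF A.pos] A.H_deriv[OF cont(1)]] .
  moreover have "((\<lambda>r. H2 (r powr \<gamma>)) has_real_derivative B.D (r powr \<gamma>) * (\<gamma> * q)) (at r)"
    unfolding q_def using DERIV_chain2[OF B.H_deriv[OF cont(2)] has_real_derivative_powr[OF r]] .
  moreover have "\<forall>\<^sub>F s in nhds r. H1 s powr \<gamma> = H2 (s powr \<gamma>)"
    using r eventually_nhds_in_open[of "{0<..}" r] by (auto elim!: eventually_mono simp: rel)
  ultimately have "\<gamma> * H1 r powr (\<gamma> - 1) * A.D r = B.D (r powr \<gamma>) * (\<gamma> * q)"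
    by (metis DERIV_cong_ev DERIV_unique)
  moreover have "H1 r powr (\<gamma> - 1) = H2 (r powr \<gamma>) / H1 r"
    using A.pos[of r] rel[OF r] by (simp add: powr_diff)
  ultimately have eq: "A.D r / H1 r = q * (B.D (r powr \<gamma>) / H2 (r powr \<gamma>))"
    using \<gamma> A.pos[of r] B.pos[of "r powr \<gamma>"] by (simp add: field_simps)
  have A: "A.tau_density r = A.D r / H1 r * (1 - r * (A.D r / H1 r))"
    using A.pos[of r]
    by (simp add: A.tau_density_def A.intercept_def power2_eq_square field_simps)
  have B: "B.tau_density s = B.D s / H2 s * (1 - s * (B.D s / H2 s))" for s
    using B.pos[of s]
    by (simp add: B.tau_density_def B.intercept_def power2_eq_square field_simps)
  show ?thesis
    unfolding A B eq q_def[symmetric] using q \<gamma> by (simp add: abs_mult mult_ac)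
qed

lemma integral_tau_density_rescale:
  assumes H: "stable_section H1" "stable_section H2" and \<gamma>: "0 < \<gamma>"
    and rel: "\<And>r. 0 < r \<Longrightarrow> H1 r powr \<gamma> = H2 (r powr \<gamma>)"
    and int: "integrable lborel (stable_section.tau_density H1)"
      "integrable lborel (stable_section.tau_density H2)"
  shows "\<gamma> * (LINT r|lborel. stable_section.tau_density H1 r) =
    (LINT r|lborel. stable_section.tau_density H2 r)"
proof -
  have halfline: "stable_section.tau_density H absolutely_integrable_on {0<..} \<and>
      integral {0<..} (stable_section.tau_density H) = (LINT r|lborel. stable_section.tau_density H r)"
    if "stable_section H" and int: "integrable lborel (stable_section.tau_density H)" for H
  proof -
    interpret stable_section H by fact
    have eq: "tau_density = (\<lambda>r. indicator {0<..} r *\<^sub>R tau_density r)"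
      by (rule ext) (use D_left in \<open>auto simp: tau_density_def indicator_def not_less\<close>)
    have "set_integrable lborel {0<..} tau_density"
      unfolding set_integrable_def using int eq by metis
    moreover have "(LINT r:{0<..}|lborel. tau_density r) = (LINT r|lborel. tau_density r)"
      unfolding set_lebesgue_integral_def using eq by metis
    ultimately show ?thesis
      using set_borel_integral_eq_integral(2)[of "{0<..}" tau_density]
      by (auto simp: absolutely_integrable_on_def set_integrable_def integrable_completion)
  qed
  interpret A: stable_section H1 by fact
  interpret B: stable_section H2 by fact
  have bij: "(\<lambda>r. r powr \<gamma>) ` {0<..} = {0<..}"
  proof (intro equalityI subsetI)
    fix s :: real assume "s \<in> {0<..}"
    then show "s \<in> (\<lambda>r. r powr \<gamma>) ` {0<..}"
      using \<gamma> by (intro image_eqI[of _ _ "s powr (1 / \<gamma>)"]) (auto simp: powr_powr)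
  qed auto
  have inj: "inj_on (\<lambda>r. r powr \<gamma>) {0<..}"
    using \<gamma> by (intro inj_on_inverseI[of _ "\<lambda>s. s powr (1 / \<gamma>)"]) (auto simp: powr_powr)
  have sub: "integral {0<..} (\<lambda>r. \<bar>\<gamma> * r powr (\<gamma> - 1)\<bar> * B.tau_density (r powr \<gamma>)) =
      (LINT r|lborel. B.tau_density r)"
    using has_absolute_integral_change_of_variables_1'[OF _ _ inj,
        of "\<lambda>r. \<gamma> * r powr (\<gamma> - 1)" B.tau_density "LINT r|lborel. B.tau_density r"]
      halfline[OF H(2) int(2)]
    by (auto simp: bij intro!: has_field_derivative_at_within has_real_derivative_powr)
  define N where "N = {r. \<not> isCont A.D r} \<union> (\<lambda>s. s powr (1 / \<gamma>)) ` {s. \<not> isCont B.D s}"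
  have "countable N" unfolding N_def by (intro countable_Un countable_image A.countable_discont B.countable_discont)
  then have "negligible N"
    by (simp add: negligible_iff_null_sets null_sets_completionI countable_imp_null_set_lborel)
  moreover have "\<bar>\<gamma> * r powr (\<gamma> - 1)\<bar> * B.tau_density (r powr \<gamma>) = \<gamma> * A.tau_density r"
    if "r \<in> {0<..} - N" for r
  proof -
    have r: "0 < r" "isCont A.D r" using that by (auto simp: N_def)
    have "isCont B.D (r powr \<gamma>)"
    proof (rule ccontr)
      assume "\<not> isCont B.D (r powr \<gamma>)"
      then have "(r powr \<gamma>) powr (1 / \<gamma>) \<in> N" by (auto simp: N_def)
      then show False using that \<gamma> by (simp add: powr_powr)
    qed
    then show ?thesis using tau_density_rescale[OF H \<gamma> rel r(1,2)] by simp
  qed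
  ultimately have "integral {0<..} (\<lambda>r. \<gamma> * A.tau_density r) =
      integral {0<..} (\<lambda>r. \<bar>\<gamma> * r powr (\<gamma> - 1)\<bar> * B.tau_density (r powr \<gamma>))"
    by (intro integral_spike) auto
  then show ?thesis
    using sub halfline[OF H(1) int(1)] by simp
qed

context stable_section
begin

text \<open>Where the section exceeds its lower bound, both factors of the density are positive.\<close>
lemma integral_tau_density_pos:
  assumes "integrable lborel tau_density" and r: "max 1 r < H r"
  shows "0 < (LINT r|lborel. tau_density r)"
proof (rule ccontr)
  assume "\<not> 0 < (LINT r|lborel. tau_density r)"
  then have "(LINT r|lborel. tau_density r) = 0"
    using tau_density_nonneg by (simp add: not_less antisym)
  then have AE: "AE s in lborel. tau_density s = 0"
    using assms(1) tau_density_nonneg by (subst (asm) integral_nonneg_eq_0_iff_AE) auto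
  have r0: "0 < r" using r left[of r] by (cases "r \<le> 0") auto
  have "((\<lambda>s. H s - s) \<longlongrightarrow> H r - r) (at r)"
    using cont[of r] by (intro tendsto_intros) (simp add: isCont_def)
  then have "\<forall>\<^sub>F s in at r. 0 < H s - s"
    using r by (intro order_tendstoD(1)) auto
  then obtain d where d: "0 < d" "\<And>s. s \<noteq> r \<Longrightarrow> dist s r < d \<Longrightarrow> 0 < H s - s"
    unfolding eventually_at by auto
  have pos: "0 < tau_density s" if s: "s \<in> {r<..<r + d}" for s
  proof -
    have "0 < r * D r" using subgradient[of r 0] left[of 0] r by (simp add: mult.commute)
    then have "0 < D r" using r0 by (simp add: zero_less_mult_iff)
    then have "0 < D s" using D_mono[of r s] s by simp
    moreover have "s * D s \<le> s * 1" using D_le_one[of s] s r0 by (intro mult_left_mono) auto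
    then have "0 < intercept s" using d(2)[of s] s by (auto simp: intercept_def dist_real_def)
    ultimately show ?thesis using pos[of s] by (simp add: tau_density_def)
  qed
  have "AE s in lborel. s \<notin> {r<..<r + d}" using AE by eventually_elim (use pos in force)
  then have "emeasure lborel {r<..<r + d} = 0"
    by (subst (asm) AE_iff_measurable[of "{r<..<r + d}"]) auto
  then show False using d(1) by simp
qed

text \<open>
  If the section equals \<open>1\<close> at \<open>1\<close>, then it is \<open>1\<close> to the left of \<open>1\<close> by monotonicity, and at most
  \<open>r\<close> to the right because its slopes are at most \<open>1\<close>.
\<close>
lemma H_one_gt_one:
  assumes "max 1 r < H r" shows "1 < H 1"
proof (rule ccontr)
  assume "\<not> 1 < H 1"
  then have H1: "H 1 = 1" using ge_one[of 1] by simp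
  show False
  proof (cases "r \<le> 1")
    case True
    then show ?thesis using H_mono[of r 1] H1 assms by simp
  next
    case False
    have "D r * (r - 1) \<le> 1 * (r - 1)" using False D_le_one[of r] by (intro mult_right_mono) auto
    then show ?thesis using subgradient[of r 1] H1 assms by (simp add: right_diff_distrib)
  qed
qed

end

lemma pickands_ends:
  assumes "pickands A" shows "A 0 = 1" "A 1 = 1"
  using assms unfolding pickands_def by (auto dest: bspec[of _ _ 0] bspec[of _ _ 1])

lemma tail_section_gt_max:
  assumes "pickands A" "\<exists>t\<in>{0..1}. A t \<noteq> pickands_M t"
  obtains r where "max 1 r < tail_section A r"
proof -
  obtain t where t: "t \<in> {0..1}" "A t \<noteq> pickands_M t" using assms(2) by blast
  then have t01: "0 < t" "t < 1"
    using pickands_ends[OF assms(1)] by (auto simp: pickands_M_def less_le)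
  have "max (1 - t) t \<le> A t" using assms(1) t(1) by (auto simp: pickands_def)
  then have "max t (1 - t) < A t" using t(2) by (simp add: pickands_M_def max.commute less_le)
  then have A: "t < A t" "1 - t < A t" by auto
  have "1 + (1 - t) / t = 1 / t" using t01 by (simp add: field_simps)
  then have "tail_section A ((1 - t) / t) = A t / t"
    using t01 by (simp add: tail_section_def tail_dep_def divide_le_0_iff)
  then have "max 1 ((1 - t) / t) < tail_section A ((1 - t) / t)"
    using A t01 by (simp add: divide_strict_right_mono)
  then show thesis by (rule that)
qed

theorem tau_pickands_integral:
  assumes "pickands A"
  shows "integrable lborel (stable_section.tau_density (tail_section A))"
    and "1 - tau_pickands A = (LINT r|lborel. stable_section.tau_density (tail_section A) r)"
proof -
  interpret stable_section "tail_section A" by (rule stable_section_tail_section) fact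
  show "integrable lborel tau_density" "1 - tau_pickands A = (LINT r|lborel. tau_density r)"
    using kendall_tau_section[OF ev_copula_eq_section_copula[OF assms]]
    by (auto simp: tau_pickands_def)
qed

lemma tau_pickands_less_one:
  assumes "pickands A" "\<exists>t\<in>{0..1}. A t \<noteq> pickands_M t"
  shows "tau_pickands A < 1"
proof -
  interpret stable_section "tail_section A" by (rule stable_section_tail_section) fact
  obtain r where "max 1 r < tail_section A r" using tail_section_gt_max[OF assms] .
  then show ?thesis
    using integral_tau_density_pos tau_pickands_integral[OF assms(1)] by fastforce
qed

lemma tau_pickands_rescale:
  assumes "pickands A1" "pickands A2" "0 < \<gamma>"
    and rel: "\<And>u v. 0 < u \<Longrightarrow> 0 < v \<Longrightarrow> tail_dep A1 u v powr \<gamma> = tail_dep A2 (u powr \<gamma>) (v powr \<gamma>)"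
  shows "\<gamma> * (1 - tau_pickands A1) = 1 - tau_pickands A2"
  unfolding tau_pickands_integral(2)[OF assms(1)] tau_pickands_integral(2)[OF assms(2)]
  using rel[of 1] assms
  by (intro integral_tau_density_rescale stable_section_tail_section tau_pickands_integral(1))
    (auto simp: tail_section_def)

section \<open>Archimedean generators\<close>

lemma generatorD:
  assumes "generator \<psi>"
  shows "0 \<le> z \<Longrightarrow> 0 \<le> \<psi> z" "0 \<le> z \<Longrightarrow> \<psi> z \<le> 1" "continuous_on {0..} \<psi>" "antimono_on {0..} \<psi>"
    "convex_on {0..} \<psi>" "\<psi> 0 = 1" "(\<psi> \<longlongrightarrow> 0) at_top" "\<psi> 1 = 1 / 2"
  using assms by (auto simp: generator_def)

text \<open>
  A convex function that takes the same positive value twice stays above this value from there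
  on, so it cannot tend to \<open>0\<close>.
\<close>
lemma generator_strict:
  assumes \<psi>: "generator \<psi>" and "0 \<le> a" "a < b" "0 < \<psi> a"
  shows "\<psi> b < \<psi> a"
proof (rule ccontr)
  assume "\<not> \<psi> b < \<psi> a"
  then have eq: "\<psi> b = \<psi> a"
    using monotone_onD[OF generatorD(4)[OF \<psi>], of a b] assms by simp
  have "\<psi> a \<le> \<psi> x" if "b < x" for x
  proof -
    define t where "t = (b - a) / (x - a)"
    have t: "0 < t" "t \<le> 1" using assms that by (auto simp: t_def)
    have "t * (x - a) = b - a" using assms that by (simp add: t_def)
    then have "(1 - t) * a + t * x = b"
      unfolding left_diff_distrib right_diff_distrib by linarith
    then have "\<psi> b \<le> (1 - t) * \<psi> a + t * \<psi> x"
      using convex_onD[OF generatorD(5)[OF \<psi>], of t a x] assms that t by auto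
    then have "t * \<psi> a \<le> t * \<psi> x" using eq by (simp add: algebra_simps)
    then show ?thesis using t by simp
  qed
  then have "\<psi> a \<le> 0"
    by (intro tendsto_lowerbound[OF generatorD(7)[OF \<psi>]])
      (auto intro: eventually_mono[OF eventually_gt_at_top[of b]])
  then show False using assms by simp
qed

lemma generator_less_one: "generator \<psi> \<Longrightarrow> 0 < z \<Longrightarrow> \<psi> z < 1"
  using generator_strict[of \<psi> 0 z] generatorD(6)[of \<psi>] by simp

lemma generator_surj:
  assumes \<psi>: "generator \<psi>" and "0 < y" "y < 1"
  obtains z where "0 < z" "\<psi> z = y"
proof -
  have "\<forall>\<^sub>F z in at_top. \<psi> z < y" using generatorD(7)[OF \<psi>] assms(2) by (rule order_tendstoD)
  then obtain b where b: "\<And>z. b \<le> z \<Longrightarrow> \<psi> z < y" unfolding eventually_at_top_linorder by blast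
  have "\<exists>z. 0 \<le> z \<and> z \<le> max 0 b \<and> \<psi> z = y"
    using b[of "max 0 b"] assms generatorD(6)[OF \<psi>]
    by (intro IVT2') (auto intro: continuous_on_subset[OF generatorD(3)[OF \<psi>]])
  then obtain z where "0 \<le> z" "\<psi> z = y" by blast
  then show thesis using that[of z] generatorD(6)[OF \<psi>] assms by (cases "z = 0") auto
qed

abbreviation generator_inverse :: "(real \<Rightarrow> real) \<Rightarrow> real \<Rightarrow> real" where
  "generator_inverse \<psi> y \<equiv> enn2real (pseudo_inverse \<psi> y)"

lemma generator_inverse_generator:
  assumes \<psi>: "generator \<psi>" and z: "0 \<le> z" "0 < \<psi> z"
  shows "generator_inverse \<psi> (\<psi> z) = z"
proof -
  have "w = ennreal z" if "generator_ext \<psi> w = \<psi> z" for w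
  proof (cases w)
    case (real r)
    then have "\<psi> r = \<psi> z" using that by (simp add: generator_ext_def)
    then have "r = z"
      using generator_strict[OF \<psi>, of r z] generator_strict[OF \<psi>, of z r] z real
      by (cases r z rule: linorder_cases) auto
    then show ?thesis using real by simp
  qed (use that z in \<open>simp add: generator_ext_def\<close>)
  then have "{w. generator_ext \<psi> w = \<psi> z} = {ennreal z}"
    using z by (auto simp: generator_ext_def)
  then show ?thesis using z by (simp add: pseudo_inverse_def)
qed

lemma generator_inverse_pos:
  assumes "generator \<psi>" "0 < y" "y < 1" shows "0 < generator_inverse \<psi> y"
  using generator_surj[OF assms] generator_inverse_generator[OF assms(1)] assms(2)
  by (metis less_imp_le)

lemma generator_generator_inverse:
  assumes "generator \<psi>" "0 < y" "y < 1" shows "\<psi> (generator_inverse \<psi> y) = y"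
  using generator_surj[OF assms] generator_inverse_generator[OF assms(1)] assms(2)
  by (metis less_imp_le)

lemma archimax_interior:
  "0 < x \<Longrightarrow> x < 1 \<Longrightarrow> 0 < y \<Longrightarrow> y < 1 \<Longrightarrow>
    archimax \<psi> A x y = \<psi> (tail_dep A (generator_inverse \<psi> x) (generator_inverse \<psi> y))"
  by (simp add: archimax_def extend_copula_def tail_dep_def Let_def)

lemma generator_rescale_sym:
  assumes "0 < \<gamma>"
  shows "(\<forall>z\<in>{0..}. \<psi>1 z = generator_pow \<gamma> \<psi>2 z) \<longleftrightarrow> (\<forall>z\<in>{0..}. \<psi>2 z = generator_pow (1 / \<gamma>) \<psi>1 z)"
  using assms unfolding generator_pow_def
  by (auto simp: powr_powr)

text \<open>This is \<open>A1 = pickands_pow \<gamma> A2\<close>, freed from the normalisation \<open>u + v = 1\<close>.\<close>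
definition tail_dep_pow_eq :: "real \<Rightarrow> (real \<Rightarrow> real) \<Rightarrow> (real \<Rightarrow> real) \<Rightarrow> bool" where
  "tail_dep_pow_eq \<gamma> A1 A2 \<longleftrightarrow>
     (\<forall>u>0. \<forall>v>0. tail_dep A1 u v powr \<gamma> = tail_dep A2 (u powr \<gamma>) (v powr \<gamma>))"

lemma tail_dep_pos: "pickands A \<Longrightarrow> 0 < u \<Longrightarrow> 0 < v \<Longrightarrow> 0 < tail_dep A u v"
  using tail_dep_bounds(1)[of A u v] by simp

lemma pickands_pow_eq_tail_dep:
  assumes "pickands A" "0 < t" "t < 1"
  shows "pickands_pow \<gamma> A t = tail_dep A (t powr \<gamma>) ((1 - t) powr \<gamma>) powr (1 / \<gamma>)"
proof -
  let ?s = "t powr \<gamma> + (1 - t) powr \<gamma>"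
  have s: "0 < ?s" using assms by (simp add: add_pos_pos)
  have "0 < tail_dep A (t powr \<gamma>) ((1 - t) powr \<gamma>)" using assms by (intro tail_dep_pos) auto
  then have "0 \<le> A (t powr \<gamma> / ?s)" using s by (simp add: tail_dep_def zero_less_mult_iff)
  then show ?thesis using s by (simp add: pickands_pow_def tail_dep_def powr_mult)
qed

lemma tail_dep_pow_eq_iff:
  assumes "pickands A1" "pickands A2" "0 < \<gamma>"
  shows "tail_dep_pow_eq \<gamma> A1 A2 \<longleftrightarrow> (\<forall>t\<in>{0..1}. A1 t = pickands_pow \<gamma> A2 t)"
proof
  assume rel: "tail_dep_pow_eq \<gamma> A1 A2"
  show "\<forall>t\<in>{0..1}. A1 t = pickands_pow \<gamma> A2 t"
  proof
    fix t :: real assume "t \<in> {0..1}"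
    then consider "t = 0" | "t = 1" | "0 < t" "t < 1" by fastforce
    then show "A1 t = pickands_pow \<gamma> A2 t"
    proof cases
      case 3
      then have "tail_dep A2 (t powr \<gamma>) ((1 - t) powr \<gamma>) = tail_dep A1 t (1 - t) powr \<gamma>"
        using rel by (simp add: tail_dep_pow_eq_def)
      then show ?thesis
        using 3 assms pickands_pow_eq_tail_dep[OF assms(2) 3] tail_dep_pos[OF assms(1), of t "1 - t"]
        by (simp add: powr_powr) (simp add: tail_dep_def)
    qed (use pickands_ends[OF assms(1)] pickands_ends[OF assms(2)] assms(3) in
        \<open>auto simp: pickands_pow_def\<close>)
  qed
next
  assume A1: "\<forall>t\<in>{0..1}. A1 t = pickands_pow \<gamma> A2 t"
  show "tail_dep_pow_eq \<gamma> A1 A2"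
    unfolding tail_dep_pow_eq_def
  proof (intro allI impI)
    fix u v :: real assume uv: "0 < u" "0 < v"
    let ?c = "u + v" let ?t = "u / (u + v)"
    have t: "0 < ?t" "?t < 1" "1 - ?t = v / ?c" "?c * ?t = u" "?c * (1 - ?t) = v"
      using uv by (auto simp: field_simps)
    have "tail_dep A1 u v powr \<gamma> = (?c * pickands_pow \<gamma> A2 ?t) powr \<gamma>"
      using A1 t by (simp add: tail_dep_def)
    also have "\<dots> = ?c powr \<gamma> * tail_dep A2 (?t powr \<gamma>) ((1 - ?t) powr \<gamma>)"
      using uv assms tail_dep_pos[OF assms(2), of "?t powr \<gamma>" "(1 - ?t) powr \<gamma>"] t(1,2)
      unfolding pickands_pow_eq_tail_dep[OF assms(2) t(1,2)]
      by (simp add: powr_mult powr_powr)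
    also have "\<dots> = tail_dep A2 (?c powr \<gamma> * ?t powr \<gamma>) (?c powr \<gamma> * (1 - ?t) powr \<gamma>)"
      using uv by (intro tail_dep_homogeneous[symmetric]) auto
    also have "\<dots> = tail_dep A2 (u powr \<gamma>) (v powr \<gamma>)"
      using uv t by (simp only: powr_mult[symmetric] less_imp_le)
    finally show "tail_dep A1 u v powr \<gamma> = tail_dep A2 (u powr \<gamma>) (v powr \<gamma>)" .
  qed
qed

lemma tail_dep_pow_eq_sym:
  assumes "pickands A1" "0 < \<gamma>" "tail_dep_pow_eq \<gamma> A1 A2"
  shows "tail_dep_pow_eq (1 / \<gamma>) A2 A1"
  unfolding tail_dep_pow_eq_def
proof (intro allI impI)
  fix u v :: real assume uv: "0 < u" "0 < v"
  have "tail_dep A1 (u powr (1 / \<gamma>)) (v powr (1 / \<gamma>)) powr \<gamma> = tail_dep A2 u v"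
    using assms uv by (simp add: tail_dep_pow_eq_def powr_powr)
  then show "tail_dep A2 u v powr (1 / \<gamma>) = tail_dep A1 (u powr (1 / \<gamma>)) (v powr (1 / \<gamma>))"
    using assms uv tail_dep_pos[OF assms(1), of "u powr (1 / \<gamma>)" "v powr (1 / \<gamma>)"]
    by (auto simp: powr_powr dest!: arg_cong[of _ "tail_dep A2 u v" "\<lambda>x. x powr (1 / \<gamma>)"])
qed

lemma archimax_eq_if_rescaled:
  assumes A: "pickands A1" "pickands A2" and \<psi>: "generator \<psi>1" "generator \<psi>2" and \<gamma>: "0 < \<gamma>"
    and gen: "\<forall>z\<in>{0..}. \<psi>1 z = generator_pow \<gamma> \<psi>2 z" and dep: "tail_dep_pow_eq \<gamma> A1 A2"
    and xy: "x \<in> {0..1}" "y \<in> {0..1}"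
  shows "archimax \<psi>1 A1 x y = archimax \<psi>2 A2 x y"
proof -
  have inv: "generator_inverse \<psi>2 y = generator_inverse \<psi>1 y powr \<gamma>" if y: "0 < y" "y < 1" for y
  proof -
    have "\<psi>2 (generator_inverse \<psi>1 y powr \<gamma>) = y"
      using gen generator_generator_inverse[OF \<psi>(1) y] generator_inverse_pos[OF \<psi>(1) y]
      by (simp add: generator_pow_def)
    then show ?thesis using generator_inverse_generator[OF \<psi>(2), of "generator_inverse \<psi>1 y powr \<gamma>"] y
      by simp
  qed
  have "\<psi>1 (tail_dep A1 (generator_inverse \<psi>1 x) (generator_inverse \<psi>1 y)) =
      \<psi>2 (tail_dep A2 (generator_inverse \<psi>2 x) (generator_inverse \<psi>2 y))"
    if xy: "0 < x" "x < 1" "0 < y" "y < 1" for x y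
  proof -
    have p: "0 < generator_inverse \<psi>1 x" "0 < generator_inverse \<psi>1 y"
      using generator_inverse_pos[OF \<psi>(1)] xy by auto
    then have "\<psi>1 (tail_dep A1 (generator_inverse \<psi>1 x) (generator_inverse \<psi>1 y)) =
        \<psi>2 (tail_dep A1 (generator_inverse \<psi>1 x) (generator_inverse \<psi>1 y) powr \<gamma>)"
      using gen tail_dep_pos[OF A(1)] by (simp add: generator_pow_def less_imp_le)
    then show ?thesis using dep p inv xy by (simp add: tail_dep_pow_eq_def)
  qed
  then show ?thesis using xy by (simp add: archimax_def extend_copula_def Let_def tail_dep_def[symmetric])
qed

section \<open>Intertwiners of stable tail dependence functions are powers\<close>

text \<open>Cauchy's functional equation on the half-line, where nonnegativity gives monotonicity.\<close>
lemma additive_nonneg_imp_linear: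
  fixes l :: "real \<Rightarrow> real"
  assumes add: "\<And>x y. 0 \<le> x \<Longrightarrow> 0 \<le> y \<Longrightarrow> l (x + y) = l x + l y"
    and nonneg: "\<And>x. 0 \<le> x \<Longrightarrow> 0 \<le> l x" and x: "0 \<le> x"
  shows "l x = x * l 1"
proof (rule ccontr)
  assume ne: "l x \<noteq> x * l 1"
  have mono: "l a \<le> l b" if "0 \<le> a" "a \<le> b" for a b
    using add[of a "b - a"] nonneg[of "b - a"] that by simp
  have mult: "l (real n * y) = real n * l y" if "0 \<le> y" for n y
  proof (induction n)
    case 0
    show ?case using add[of 0 0] by simp
  next
    case (Suc n)
    then show ?case using add[of "real n * y" y] that by (simp add: algebra_simps)
  qed
  have bound: "\<bar>real n * (l x - x * l 1)\<bar> \<le> l 1" for n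
  proof -
    define k where "k = nat \<lfloor>real n * x\<rfloor>"
    have k: "real k \<le> real n * x" "real n * x \<le> real (Suc k)"
      using x by (simp_all add: k_def) linarith+
    have "real k * l 1 \<le> real n * l x" "real n * l x \<le> real (Suc k) * l 1"
      using mono[OF _ k(1)] mono[OF _ k(2)] mult[of 1 k] mult[of 1 "Suc k"] mult[of x n] x by auto
    moreover have "real k * l 1 \<le> real n * x * l 1" "real n * x * l 1 \<le> real (Suc k) * l 1"
      using k nonneg[of 1] by (auto intro: mult_right_mono)
    ultimately show ?thesis by (simp add: algebra_simps abs_le_iff)
  qed
  obtain n where "l 1 / \<bar>l x - x * l 1\<bar> < real n" using reals_Archimedean2 by blast
  then show False using bound[of n] ne by (simp add: divide_less_eq abs_mult)
qed

lemma exists_power_in_window: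
  fixes c :: real
  assumes "1 < c" "0 < u" "u \<le> m"
  obtains n where "m / c < u * c ^ n" "u * c ^ n \<le> m"
proof -
  have "\<exists>n. m < u * c ^ n"
    using real_arch_pow[OF assms(1), of "m / u"] assms by (auto simp: divide_less_eq mult.commute)
  then have L: "m < u * c ^ (LEAST n. m < u * c ^ n)" by (rule LeastI_ex)
  define N where "N = (LEAST n. m < u * c ^ n)"
  have "N \<noteq> 0" using L assms by (metis N_def linorder_not_le mult.right_neutral power_0)
  then obtain n where n: "N = Suc n" by (cases N) auto
  then have "\<not> m < u * c ^ n" using not_less_Least[of n "\<lambda>n. m < u * c ^ n"] by (simp add: N_def[symmetric])
  moreover have "m / c < u * c ^ n" using L n assms by (simp add: N_def[symmetric] divide_less_eq mult_ac)
  ultimately show thesis using that[of n] by simp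
qed

text \<open>
  The set \<open>I\<close> is an interval \<open>(0, \<omega>)\<close> with \<open>1 < \<omega> \<le> \<infinity>\<close> in the application, where \<open>\<omega>\<close> is the first zero of a generator; the
  equation is available only as long as \<open>tail_dep A1 u v\<close> stays in it. Restricting to factors
  \<open>s \<le> 1\<close> keeps all points inside.
\<close>
theorem intertwiner_is_power:
  fixes f :: "real \<Rightarrow> real" and I :: "real set"
  assumes A: "pickands A1" "pickands A2" and diag: "1 < tail_dep A1 1 1"
    and I: "1 \<in> I" "\<And>u. u \<in> I \<Longrightarrow> 0 < u" "\<And>u w. u \<in> I \<Longrightarrow> 0 < w \<Longrightarrow> w \<le> u \<Longrightarrow> w \<in> I"
    and f: "f 1 = 1" "\<And>u. u \<in> I \<Longrightarrow> 0 < f u" "strict_mono_on I f" "continuous_on I f"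
    and onto: "\<And>u w. u \<in> I \<Longrightarrow> 0 < w \<Longrightarrow> w \<le> f u \<Longrightarrow> w \<in> f ` I"
    and eq: "\<And>u v. 0 < u \<Longrightarrow> 0 < v \<Longrightarrow> tail_dep A1 u v \<in> I \<Longrightarrow> f (tail_dep A1 u v) = tail_dep A2 (f u) (f v)"
  shows "\<exists>\<gamma>>0. \<forall>u\<in>I. f u = u powr \<gamma>"
proof -
  interpret stable_section "tail_section A1" by (rule stable_section_tail_section) fact
  let ?h = "tail_section A1"
  define c where "c = tail_dep A1 1 1"
  define d where "d = tail_dep A2 1 1"
  have c1: "1 < c" using diag by (simp add: c_def)
  have hc: "?h 1 = c" by (simp add: tail_section_def c_def)
  have period: "f (c * x) = d * f x" if "c * x \<in> I" "0 < x" for x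
  proof -
    have "x \<in> I" using I(3)[OF that(1), of x] that c1 by simp
    then have "f x \<noteq> 0" using f(2)[of x] by simp
    then have "tail_dep A2 (f x) (f x) = d * f x"
      using tail_dep_homogeneous[of "f x" A2 1 1] by (simp add: d_def)
    moreover have "tail_dep A1 x x = c * x"
      using tail_dep_homogeneous[of x A1 1 1] that(2) by (simp add: c_def)
    ultimately show ?thesis using eq[of x x] that by metis
  qed
  have mult: "f (s * x) = f s * f x" if s: "0 < s" "s \<le> 1" and x: "x \<in> I" for s x
  proof -
    define F where "F x = f (s * x) / f x" for x
    have sI: "s * x \<in> I" if "x \<in> I" for x
      using I(3)[OF that, of "s * x"] I(2)[OF that] s by simp
    have F_pos: "0 < F x" if "x \<in> I" for x
      using f(2)[OF that] f(2)[OF sI[OF that]] by (simp add: F_def)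
    have F_period: "F (x * c ^ n) = F x" if "x * c ^ n \<in> I" "0 < x" for x n
      using that
    proof (induction n)
      case (Suc n)
      have xn: "0 < x * c ^ n" using Suc.prems c1 by simp
      have in_I: "c * (x * c ^ n) \<in> I" using Suc.prems by (simp add: mult_ac)
      have n_I: "x * c ^ n \<in> I" using I(3)[OF in_I xn] mult_right_mono[of 1 c "x * c ^ n"] xn c1 by simp
      have "c * (s * (x * c ^ n)) \<in> I" using sI[OF in_I] by (simp add: mult_ac)
      then have "f (s * (c * (x * c ^ n))) = d * f (s * (x * c ^ n))"
        using period[of "s * (x * c ^ n)"] s xn by (simp add: mult_ac)
      moreover have "f (c * (x * c ^ n)) = d * f (x * c ^ n)" using period in_I xn by simp
      moreover have "d \<noteq> 0" using calculation(2) f(2)[OF in_I] by fastforce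
      ultimately have "F (c * (x * c ^ n)) = F (x * c ^ n)"
        by (simp only: F_def mult_divide_mult_cancel_left not_False_eq_True)
      then show ?case using Suc.IH[OF n_I Suc.prems(2)] by (simp add: mult_ac)
    qed simp
    have const: "F a = F m0" if m0: "m0 \<in> I" and a: "0 < a" "a \<le> m0" for a m0
    proof -
      have m0_pos: "0 < m0" using I(2) m0 .
      have pos: "0 < m0 / c" using m0_pos c1 by simp
      have below: "w \<in> I" if "0 < w" "w \<le> m0" for w using I(3)[OF m0 that] .
      \<comment> \<open>By periodicity the maximum over one period is the maximum over \<open>(0, m0]\<close>.\<close>
      have "\<exists>m\<in>{m0 / c..m0}. \<forall>w\<in>{m0 / c..m0}. F w \<le> F m"
      proof (rule continuous_attains_sup)
        have sub: "{m0 / c..m0} \<subseteq> I"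
          by (rule subsetI, rule below) (simp_all add: less_le_trans[OF pos])
        have "continuous_on {m0 / c..m0} (\<lambda>x. f (s * x))"
          by (rule continuous_on_compose2[OF f(4)]) (use sub sI in \<open>auto intro!: continuous_intros\<close>)
        moreover have "continuous_on {m0 / c..m0} f" using f(4) sub by (rule continuous_on_subset)
        moreover have "f x \<noteq> 0" if "x \<in> {m0 / c..m0}" for x using f(2)[of x] that sub by auto
        ultimately show "continuous_on {m0 / c..m0} F"
          unfolding F_def by (intro continuous_on_divide) auto
      qed (use m0_pos c1 in \<open>auto simp: divide_le_eq\<close>)
      then obtain m where m: "m0 / c \<le> m" "m \<le> m0" and max: "\<And>w. m0 / c \<le> w \<Longrightarrow> w \<le> m0 \<Longrightarrow> F w \<le> F m"
        by auto
      have m_pos: "0 < m" by (rule less_le_trans[OF pos m(1)])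
      have mI: "m \<in> I" using below m_pos m by simp
      have le_max: "F w \<le> F m" if w: "0 < w" "w \<le> m0" for w
      proof -
        obtain n where "m0 / c < w * c ^ n" "w * c ^ n \<le> m0"
          using exists_power_in_window[OF c1 w] .
        moreover have "w * c ^ n \<in> I" using below calculation w c1 by simp
        ultimately show ?thesis using max[of "w * c ^ n"] F_period[of w n] w by simp
      qed
      have window: "F u = F m" if u: "m / c \<le> u" "u < m" for u
      proof (rule antisym)
        have u_pos: "0 < u" using less_le_trans[OF divide_pos_pos[OF m_pos] u(1)] c1 by simp
        show "F u \<le> F m" using le_max u_pos u m by simp
        show "F m \<le> F u"
        proof (rule ccontr)
          assume less: "\<not> F m \<le> F u"
          \<comment> \<open>Since \<open>?h 0 = 1\<close> and \<open>?h 1 = c\<close>, the point \<open>m\<close> is \<open>tail_dep A1 u (r * u)\<close> for some \<open>r\<close> in \<open>(0, 1]\<close>.\<close>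
          have mu: "1 < m / u" "m / u \<le> c" using u u_pos c1 by (auto simp: field_simps)
          have "\<exists>r. 0 \<le> r \<and> r \<le> 1 \<and> ?h r = m / u"
            using mu left[of 0] hc by (intro IVT' continuous_H) auto
          then obtain r where r: "0 \<le> r" "r \<le> 1" "?h r = m / u" by blast
          then have r0: "0 < r" using left[of 0] mu by (cases "r = 0") auto
          define v where "v = r * u"
          have v: "0 < v" using r0 u_pos by (simp add: v_def)
          have N: "tail_dep A1 u v = m"
            using tail_dep_eq_tail_section[OF u_pos v, of A1] r u_pos by (simp add: v_def)
          \<comment> \<open>This is the condition for strict monotonicity in the first argument.\<close>
          have v_less: "v < m"
          proof -
            have "v \<le> u" using r u_pos by (simp add: v_def)
            then show ?thesis using u by simp
          qed
          have uI: "u \<in> I" and vI: "v \<in> I" using below u_pos v u v_less m by auto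
          have "f (s * m) = f (tail_dep A1 (s * u) (s * v))"
            using tail_dep_homogeneous[of s A1 u v] s N by simp
          also have "\<dots> = tail_dep A2 (f (s * u)) (f (s * v))"
            using eq[of "s * u" "s * v"] tail_dep_homogeneous[of s A1 u v] s N sI[OF mI] u_pos v by simp
          also have "\<dots> \<le> tail_dep A2 (f (s * u)) (F m * f v)"
          proof (rule tail_dep_mono_right[OF A(2)])
            show "f (s * v) \<le> F m * f v"
              using le_max[of v] v v_less m f(2)[OF vI] by (simp add: F_def divide_le_eq)
          qed (use f(2) sI uI vI in auto)
          also have "\<dots> = F m * tail_dep A2 (f (s * u) / F m) (f v)"
            using tail_dep_homogeneous[of "F m" A2 "f (s * u) / F m" "f v"] F_pos[OF mI] by simp
          also have "\<dots> < F m * f m"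
          proof -
            have lt: "f (s * u) / F m < f u"
            proof -
              have "f (s * u) / f u < F m" using less by (simp only: F_def[of u] not_le)
              then show ?thesis using F_pos[OF mI] f(2)[OF uI] by (simp add: divide_less_eq mult.commute)
            qed
            have gt: "0 < f (s * u) / F m" using f(2)[OF sI[OF uI]] F_pos[OF mI] by simp
            obtain u' where u': "u' \<in> I" "f u' = f (s * u) / F m"
              using onto[OF uI gt less_imp_le[OF lt]] by auto
            then have "u' < u" using lt strict_mono_on_less[OF f(3) u'(1) uI] by simp
            then have N': "tail_dep A1 u' v < m"
              using tail_dep_strict_mono_left[OF A(1) I(2)[OF u'(1)] _ v, of u] N v_less by simp
            have pos': "0 < tail_dep A1 u' v" using tail_dep_pos[OF A(1) I(2)[OF u'(1)] v] .
            have N'I: "tail_dep A1 u' v \<in> I" using I(3)[OF mI pos'] N' by simp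
            then have "tail_dep A2 (f u') (f v) < f m"
              using eq[OF I(2)[OF u'(1)] v N'I] strict_mono_onD[OF f(3) N'I mI N'] by simp
            then show ?thesis using u' F_pos[OF mI] by simp
          qed
          also have "\<dots> = f (s * m)" using f(2)[OF mI] by (simp add: F_def)
          finally show False by simp
        qed
      qed
      have all: "F x = F m" if x: "0 < x" "x \<le> m0" for x
      proof -
        have "x / c \<le> m0 / c" using c1 by (intro divide_right_mono[OF x(2)]) linarith
        then have x': "0 < x / c" "x / c \<le> m"
          using m(1) x(1) c1 by (linarith | simp)+
        obtain n where n: "m / c < x / c * c ^ n" "x / c * c ^ n \<le> m"
          using exists_power_in_window[OF c1 x'] .
        have "0 < c ^ n" using c1 by simp
        then have "0 < x / c * c ^ n" by (rule mult_pos_pos[OF x'(1)])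
        then have "x / c * c ^ n \<in> I" using n(2) by (rule I(3)[OF mI])
        then have "F (x / c * c ^ n) = F (x / c)" using x'(1) by (rule F_period)
        then have "F (x / c) = F (x / c * c ^ n)" by (rule sym)
        also have "\<dots> = F m"
        proof (cases "x / c * c ^ n = m")
          case False
          then show ?thesis
            using n(2) by (intro window[OF less_imp_le[OF n(1)]]) (simp only: less_le simp_thms)
        qed (simp only:)
        also have "F (x / c) = F x"
        proof -
          have "x / c * c ^ 1 = x" using c1 by simp
          then show ?thesis using F_period[OF _ x'(1), of 1] below[OF x] by (simp only:)
        qed
        finally show ?thesis .
      qed
      show ?thesis by (simp only: all[OF a] all[OF m0_pos order_refl])
    qed
    have "F x = F 1"
    proof (cases "x \<le> 1")
      case True
      then show ?thesis by (rule const[OF I(1) I(2)[OF x]])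
    next
      case False
      then have "F 1 = F x" by (intro const[OF x]) auto
      then show ?thesis by (rule sym)
    qed
    then show ?thesis using f(1) f(2)[OF x] by (simp add: F_def field_simps)
  qed
  \<comment> \<open>In logarithmic coordinates \<open>f\<close> is additive on the half-line that corresponds to \<open>(0, 1]\<close>.\<close>
  define l where "l x = - ln (f (exp (- x)))" for x
  have eI: "exp (- x) \<in> I" if "0 \<le> x" for x using I(3)[OF I(1)] that by simp
  have l_pos: "0 \<le> l x" if "0 \<le> x" for x
  proof -
    have "f (exp (- x)) \<le> f 1"
      using strict_mono_on_leD[OF f(3) eI[OF that] I(1)] that by simp
    then show ?thesis using f(1) f(2)[OF eI[OF that]] by (simp add: l_def)
  qed
  have l_lin: "l x = x * l 1" if "0 \<le> x" for x
  proof (rule additive_nonneg_imp_linear[OF _ l_pos that])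
    fix x y :: real assume xy: "0 \<le> x" "0 \<le> y"
    have "exp (- (x + y)) = exp (- x) * exp (- y)" by (simp flip: exp_add)
    also have "f \<dots> = f (exp (- x)) * f (exp (- y))"
      using mult[of "exp (- x)" "exp (- y)"] eI[OF xy(2)] xy(1) by simp
    finally show "l (x + y) = l x + l y"
      using f(2)[OF eI[OF xy(1)]] f(2)[OF eI[OF xy(2)]] by (simp only: l_def ln_mult_pos minus_add_distrib)
  qed simp
  have small: "f s = s powr l 1" if "0 < s" "s \<le> 1" for s
  proof -
    have "l (- ln s) = - ln s * l 1" using that by (intro l_lin) simp
    moreover have "l (- ln s) = - ln (f s)" using that by (simp add: l_def)
    ultimately have ln_f: "ln (f s) = l 1 * ln s" by (simp add: mult.commute)
    have "f s = exp (ln (f s))" using f(2)[OF I(3)[OF I(1) that]] by simp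
    also have "\<dots> = s powr l 1" unfolding ln_f using that by (simp add: powr_def)
    finally show ?thesis .
  qed
  have "f (exp (- 1)) < f 1"
    using strict_mono_onD[OF f(3) eI[of 1] I(1)] by simp
  then have "0 < l 1" using f(1) f(2)[OF eI[of 1]] by (simp add: l_def)
  moreover have "f u = u powr l 1" if u: "u \<in> I" for u
  proof (cases "u \<le> 1")
    case False
    have "f (1 / u * u) = f (1 / u) * f u" using False by (intro mult u) auto
    moreover have "1 / u * u = 1" using False by simp
    moreover have "f (1 / u) = 1 / u powr l 1" using small[of "1 / u"] False by (simp add: powr_divide)
    ultimately have "1 = 1 / u powr l 1 * f u" using f(1) by (simp only:)
    then show ?thesis using False by (simp add: eq_divide_eq)
  qed (use small I(2)[OF u] in auto)
  ultimately show ?thesis by blast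
qed

section \<open>Equality of Archimax copulas\<close>

text \<open>
  The intertwining function is \<open>f = \<phi>\<^sub>2 \<circ> \<psi>\<^sub>1\<close> on the set where \<open>\<psi>\<^sub>1\<close> is positive. It is continuous
  because it is strictly increasing and maps onto an open set. That its power law extends past the zeros of
  \<open>\<psi>\<^sub>1\<close> follows from surjectivity: no point outside \<open>I1\<close> can have its power in \<open>I2\<close>.
\<close>
lemma rescaled_if_archimax_eq:
  assumes A: "pickands A1" "pickands A2" and ne: "\<exists>t\<in>{0..1}. A1 t \<noteq> pickands_M t"
    and \<psi>: "generator \<psi>1" "generator \<psi>2"
    and eq: "\<forall>x\<in>{0..1}. \<forall>y\<in>{0..1}. archimax \<psi>1 A1 x y = archimax \<psi>2 A2 x y"
  obtains \<gamma> where "0 < \<gamma>" "\<forall>z\<in>{0..}. \<psi>1 z = generator_pow \<gamma> \<psi>2 z" "tail_dep_pow_eq \<gamma> A1 A2"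
proof -
  define f where "f z = generator_inverse \<psi>2 (\<psi>1 z)" for z
  define I1 where "I1 = {z. 0 < z \<and> 0 < \<psi>1 z}"
  define I2 where "I2 = {z. 0 < z \<and> 0 < \<psi>2 z}"
  have I1_D: "0 < u" "0 < \<psi>1 u" "\<psi>1 u < 1" if "u \<in> I1" for u
    using that generator_less_one[OF \<psi>(1)] by (auto simp: I1_def)
  have f: "0 < f u" "\<psi>2 (f u) = \<psi>1 u" if "u \<in> I1" for u
    using I1_D[OF that] generator_inverse_pos[OF \<psi>(2)] generator_generator_inverse[OF \<psi>(2)]
    by (auto simp: f_def)
  have onto: "z \<in> f ` I1" if "z \<in> I2" for z
  proof -
    have z: "0 < z" "0 < \<psi>2 z" "\<psi>2 z < 1" using that generator_less_one[OF \<psi>(2)] by (auto simp: I2_def)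
    define u where "u = generator_inverse \<psi>1 (\<psi>2 z)"
    have "0 < u" "\<psi>1 u = \<psi>2 z"
      using z generator_inverse_pos[OF \<psi>(1)] generator_generator_inverse[OF \<psi>(1)] by (auto simp: u_def)
    then show ?thesis
      using z generator_inverse_generator[OF \<psi>(2), of z]
      by (intro image_eqI[of _ _ u]) (auto simp: f_def I1_def)
  qed
  have f_mono: "f u < f v" if uv: "u \<in> I1" "v \<in> I1" "u < v" for u v
  proof (rule ccontr)
    assume "\<not> f u < f v"
    then have "\<psi>2 (f u) \<le> \<psi>2 (f v)"
      using monotone_onD[OF generatorD(4)[OF \<psi>(2)], of "f v" "f u"] f(1)[OF uv(1)] f(1)[OF uv(2)] by auto
    moreover have "\<psi>1 v < \<psi>1 u" using generator_strict[OF \<psi>(1)] uv I1_D[OF uv(1)] by auto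
    ultimately show False using f(2) uv by simp
  qed
  have one: "1 \<in> I1" using generatorD(8)[OF \<psi>(1)] by (simp add: I1_def)
  have f1: "f 1 = 1"
    using generator_inverse_generator[OF \<psi>(2), of 1]
    by (simp add: f_def generatorD(8)[OF \<psi>(1)] generatorD(8)[OF \<psi>(2)])
  have down: "w \<in> I1" if "u \<in> I1" "0 < w" "w \<le> u" for u w
    using monotone_onD[OF generatorD(4)[OF \<psi>(1)], of w u] that by (auto simp: I1_def)
  have "open I2"
  proof -
    have "continuous_on {0<..} \<psi>2" using generatorD(3)[OF \<psi>(2)] by (rule continuous_on_subset) auto
    then have "open ({0<..} \<inter> \<psi>2 -` {0<..})" by (intro continuous_open_preimage) auto
    moreover have "{0<..} \<inter> \<psi>2 -` {0<..} = I2" by (auto simp: I2_def)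
    ultimately show ?thesis by simp
  qed
  moreover have "f ` I1 = I2" using onto f I1_D by (auto simp: I2_def)
  ultimately have f_cont: "continuous_on I1 f"
    using f_mono by (intro continuous_onI_mono) (auto simp: le_less)
  have func: "f (tail_dep A1 u v) = tail_dep A2 (f u) (f v)"
    if uv: "0 < u" "0 < v" and N: "tail_dep A1 u v \<in> I1" for u v
  proof -
    have uvI: "u \<in> I1" "v \<in> I1" using down[OF N] uv tail_dep_bounds[OF A(1), of u v] by auto
    have inv: "generator_inverse \<psi>1 (\<psi>1 w) = w" if "w \<in> I1" for w
      using generator_inverse_generator[OF \<psi>(1), of w] I1_D[OF that] by simp
    have "\<psi>1 (tail_dep A1 u v) = archimax \<psi>1 A1 (\<psi>1 u) (\<psi>1 v)"
      using uvI by (simp add: archimax_interior I1_D inv)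
    also have "\<dots> = archimax \<psi>2 A2 (\<psi>1 u) (\<psi>1 v)"
      using eq I1_D[OF uvI(1)] I1_D[OF uvI(2)] by simp
    also have "\<dots> = \<psi>2 (tail_dep A2 (f u) (f v))"
      using uvI by (simp add: archimax_interior I1_D f_def)
    finally have *: "\<psi>1 (tail_dep A1 u v) = \<psi>2 (tail_dep A2 (f u) (f v))" .
    have "0 \<le> tail_dep A2 (f u) (f v)" using tail_dep_pos[OF A(2) f(1)[OF uvI(1)] f(1)[OF uvI(2)]] by simp
    then show ?thesis
      using generator_inverse_generator[OF \<psi>(2)] I1_D(2)[OF N] unfolding f_def[of "tail_dep A1 u v"] * by auto
  qed
  obtain r where "max 1 r < tail_section A1 r" using tail_section_gt_max[OF A(1) ne] .
  then have "1 < tail_section A1 1"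
    by (rule stable_section.H_one_gt_one[OF stable_section_tail_section[OF A(1)]])
  then have c: "1 < tail_dep A1 1 1" by (simp add: tail_section_def)
  have range: "w \<in> f ` I1" if u: "u \<in> I1" and w: "0 < w" "w \<le> f u" for u w
  proof -
    have "\<psi>2 (f u) \<le> \<psi>2 w" using monotone_onD[OF generatorD(4)[OF \<psi>(2)], of w "f u"] w by simp
    then have "w \<in> I2" using f(2)[OF u] I1_D(2)[OF u] w by (simp add: I2_def)
    then show ?thesis by (rule onto)
  qed
  have sm: "strict_mono_on I1 f" by (rule strict_mono_onI) (rule f_mono)
  have "\<exists>\<gamma>>0. \<forall>u\<in>I1. f u = u powr \<gamma>"
    by (rule intertwiner_is_power[OF A c one _ _ f1 _ sm f_cont]) (fact I1_D(1) down f(1) range func)+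
  then obtain \<gamma> where \<gamma>: "0 < \<gamma>" "\<And>u. u \<in> I1 \<Longrightarrow> f u = u powr \<gamma>" by blast
  have gen: "\<psi>1 z = generator_pow \<gamma> \<psi>2 z" if "0 \<le> z" for z
  proof (cases "z = 0 \<or> z \<in> I1")
    case True
    then show ?thesis
      using generatorD(6)[OF \<psi>(1)] generatorD(6)[OF \<psi>(2)] f(2)[of z] \<gamma> by (auto simp: generator_pow_def)
  next
    case False
    then have z: "0 < z" "\<psi>1 z = 0" using that generatorD(1)[OF \<psi>(1), of z] by (auto simp: I1_def)
    have "z powr \<gamma> \<notin> I2"
    proof
      assume "z powr \<gamma> \<in> I2"
      then obtain u where u: "u \<in> I1" "z powr \<gamma> = f u" using onto by blast
      then have "(z powr \<gamma>) powr (1 / \<gamma>) = (u powr \<gamma>) powr (1 / \<gamma>)" using \<gamma>(2) by simp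
      then have "z = u" using z I1_D(1)[OF u(1)] \<gamma>(1) by (simp add: powr_powr)
      then show False using u(1) False by simp
    qed
    then show ?thesis
      using z generatorD(1)[OF \<psi>(2), of "z powr \<gamma>"] by (auto simp: I2_def generator_pow_def)
  qed
  have "tail_dep_pow_eq \<gamma> A1 A2"
    unfolding tail_dep_pow_eq_def
  proof (intro allI impI)
    fix u v :: real assume uv: "0 < u" "0 < v"
    \<comment> \<open>Homogeneity moves any pair to one where the functional equation is available.\<close>
    define a where "a = 1 / tail_dep A1 u v"
    have N: "0 < tail_dep A1 u v" using tail_dep_pos[OF A(1) uv] .
    then have a: "0 < a" by (simp add: a_def)
    have aN: "tail_dep A1 (a * u) (a * v) = 1"
      using a N tail_dep_homogeneous[of a A1 u v] by (simp add: a_def)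
    have "a * u \<in> I1" "a * v \<in> I1"
      using down[OF one] a uv tail_dep_bounds[OF A(1), of "a * u" "a * v"] aN by (auto simp: add_pos_pos)
    then have "1 = tail_dep A2 ((a * u) powr \<gamma>) ((a * v) powr \<gamma>)"
      using func[of "a * u" "a * v"] aN one f1 a uv \<gamma>(2) by simp
    also have "\<dots> = a powr \<gamma> * tail_dep A2 (u powr \<gamma>) (v powr \<gamma>)"
      using a uv tail_dep_homogeneous[of "a powr \<gamma>"] by (simp add: powr_mult)
    also have "a powr \<gamma> = 1 / tail_dep A1 u v powr \<gamma>"
      using N by (simp add: a_def powr_divide)
    finally show "tail_dep A1 u v powr \<gamma> = tail_dep A2 (u powr \<gamma>) (v powr \<gamma>)"
      using N by (simp add: field_simps)
  qed
  then show thesis using that[OF \<gamma>(1)] gen by simp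
qed

theorem theorem1:
  fixes A1 A2 \<psi>1 \<psi>2 :: "real \<Rightarrow> real"
  assumes "pickands A1" and "\<exists>t\<in>{0..1}. A1 t \<noteq> pickands_M t"
    and "pickands A2" and "\<exists>t\<in>{0..1}. A2 t \<noteq> pickands_M t"
    and "generator \<psi>1" and "generator \<psi>2"
  shows "(\<forall>x\<in>{0..1}. \<forall>y\<in>{0..1}. archimax \<psi>1 A1 x y = archimax \<psi>2 A2 x y) \<longleftrightarrow>
    (tau_pickands A1 \<le> tau_pickands A2 \<and>
     (\<forall>z\<in>{0..}. \<forall>t\<in>{0..1}.
        \<psi>1 z = generator_pow ((1 - tau_pickands A2) / (1 - tau_pickands A1)) \<psi>2 z \<and>
        A2 t = pickands_pow ((1 - tau_pickands A1) / (1 - tau_pickands A2)) A1 t)) \<or>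
    (tau_pickands A1 > tau_pickands A2 \<and>
     (\<forall>z\<in>{0..}. \<forall>t\<in>{0..1}.
        \<psi>2 z = generator_pow ((1 - tau_pickands A1) / (1 - tau_pickands A2)) \<psi>1 z \<and>
        A1 t = pickands_pow ((1 - tau_pickands A2) / (1 - tau_pickands A1)) A2 t))"
proof -
  define g where "g = (1 - tau_pickands A2) / (1 - tau_pickands A1)"
  have tau: "tau_pickands A1 < 1" "tau_pickands A2 < 1"
    using tau_pickands_less_one assms(1-4) by auto
  then have g: "0 < g" by (simp add: g_def)
  have g_inv: "(1 - tau_pickands A1) / (1 - tau_pickands A2) = 1 / g" by (simp add: g_def)
  let ?gen = "\<forall>z\<in>{0..}. \<psi>1 z = generator_pow g \<psi>2 z"
  have eqv: "(\<forall>x\<in>{0..1}. \<forall>y\<in>{0..1}. archimax \<psi>1 A1 x y = archimax \<psi>2 A2 x y) \<longleftrightarrow>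
      ?gen \<and> tail_dep_pow_eq g A1 A2" (is "?eq \<longleftrightarrow> _")
  proof
    assume ?eq
    then obtain \<gamma> where \<gamma>: "0 < \<gamma>" "\<forall>z\<in>{0..}. \<psi>1 z = generator_pow \<gamma> \<psi>2 z" "tail_dep_pow_eq \<gamma> A1 A2"
      using rescaled_if_archimax_eq[OF assms(1,3,2,5,6)] by metis
    have "\<gamma> * (1 - tau_pickands A1) = 1 - tau_pickands A2"
      using \<gamma>(3) unfolding tail_dep_pow_eq_def by (intro tau_pickands_rescale[OF assms(1,3) \<gamma>(1)]) simp
    then have "\<gamma> = g" using tau by (simp add: g_def eq_divide_eq)
    then show "?gen \<and> tail_dep_pow_eq g A1 A2" using \<gamma> by simp
  next
    assume "?gen \<and> tail_dep_pow_eq g A1 A2"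
    then show ?eq by (intro ballI archimax_eq_if_rescaled[OF assms(1,3,5,6) g]) auto
  qed
  have gen_sym: "?gen \<longleftrightarrow> (\<forall>z\<in>{0..}. \<psi>2 z = generator_pow (1 / g) \<psi>1 z)"
    by (rule generator_rescale_sym[OF g])
  have dep1: "tail_dep_pow_eq g A1 A2 \<longleftrightarrow> (\<forall>t\<in>{0..1}. A1 t = pickands_pow g A2 t)"
    by (rule tail_dep_pow_eq_iff[OF assms(1,3) g])
  have "tail_dep_pow_eq g A1 A2 \<longleftrightarrow> tail_dep_pow_eq (1 / g) A2 A1"
  proof
    assume "tail_dep_pow_eq (1 / g) A2 A1"
    then have "tail_dep_pow_eq (1 / (1 / g)) A1 A2"
      using g by (intro tail_dep_pow_eq_sym[OF assms(3)]) auto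
    then show "tail_dep_pow_eq g A1 A2" by simp
  qed (rule tail_dep_pow_eq_sym[OF assms(1) g])
  also have "\<dots> \<longleftrightarrow> (\<forall>t\<in>{0..1}. A2 t = pickands_pow (1 / g) A1 t)"
    using g by (intro tail_dep_pow_eq_iff[OF assms(3,1)]) simp
  finally have dep2: "tail_dep_pow_eq g A1 A2 \<longleftrightarrow> (\<forall>t\<in>{0..1}. A2 t = pickands_pow (1 / g) A1 t)" .
  have split: "(\<forall>z\<in>{0..}. \<forall>t\<in>{0..1}. P z \<and> Q t) \<longleftrightarrow> (\<forall>z\<in>{0..}. P z) \<and> (\<forall>t\<in>{0..1}. Q t)"
    for P Q :: "real \<Rightarrow> bool"
  proof -
    have "0 \<in> {0::real..}" "0 \<in> {0..1::real}" by auto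
    then show ?thesis by blast
  qed
  show ?thesis
    unfolding g_inv g_def[symmetric] split eqv dep1[symmetric] dep2[symmetric] gen_sym[symmetric]
    by (cases "tau_pickands A1 \<le> tau_pickands A2") (simp_all add: not_le)
qed

end
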